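(* Let $X$ and $Y$ be complex infinite-dimensional Banach spaces, $A\in B(X)$, $B\in B(Y)$, $C\in B(Y,X)$, and let $M_C=\begin{pmatrix}A&C\\0&B\end{pmatrix}\in B(X\oplus Y)$. If $\sigma_*$ is any one of $\sigma_l,\sigma_{lb},\sigma_{ab},\sigma_{le},\sigma_{SF+}$, then $$\sigma_*(M_C)\cup S(A^* )=\sigma_*(A)\cup\sigma_*(B)\cup S(A^* ).$$
   Context: $B(Y,X)$ is the set of bounded linear operators from $Y$ to $X$, and $B(X)=B(X,X)$. $A^*\in B(X^* )$ is the dual operator of $A$. For $T\in B(X)$ let $\alpha(T)=\dim N(T)$, where $N(T)$ and $R(T)$ are the kernel and range. The ascent $asc(T)$ is the smallest nonnegative integer $k$ with $N(T^k)=N(T^{k+1})$ ($\infty$ if none exists). Operator classes: $\Phi_+(X)=\{T:\alpha(T)<\infty\text{ and }R(T)\text{ is closed}\}$; $\Phi_l(X)=\{T: R(T)\text{ is a closed and complemented subspace of }X\text{ and }\alpha(T)<\infty\}$; $\Phi_{ab}(X)=\{T\in\Phi_+(X): asc(T)<\infty\}$; $\Phi_{lb}(X)=\{T\in\Phi_l(X): asc(T)<\infty\}$. Spectra: $\sigma_l(T)=\{\lambda\in\mathbb{C}:T-\lambda I\text{ is not left invertible in }B(X)\}$; $\sigma_{lb}(T)=\{\lambda\in\mathbb{C}:T-\lambda I\notin\Phi_{lb}(X)\}$; $\sigma_{ab}(T)=\{\lambda\in\mathbb{C}:T-\lambda I\notin\Phi_{ab}(X)\}$; $\sigma_{le}(T)=\{\lambda\in\mathbb{C}:T-\lambda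 I\notin\Phi_l(X)\}$; $\sigma_{SF+}(T)=\{\lambda\in\mathbb{C}:T-\lambda I\notin\Phi_+(X)\}$. The same definitions apply on $Y$ and $X\oplus Y$. $T$ has the single valued extension property (SVEP) at $\lambda\in\mathbb{C}$ if there is $r>0$ such that for every open subset $V$ of the open disc $D(\lambda,r)$, the function $f\equiv 0$ is the only analytic solution of $(T-\mu)f(\mu)=0$ for all $\mu\in V$. $S(T)=\{\lambda\in\mathbb{C}: T\text{ fails to have the SVEP at }\lambda\}$. *)

theory Defs
  imports "HOL-Analysis.Analysis" "HOL-Library.Extended_Nat"
begin

section \<open>Complex normed and Banach spaces\<close>

text \<open>The real structure (and hence the norm, metric and topology) is that of the library;
  the complex scalar multiplication extends the real one.\<close>

class complex_normed_vector = real_normed_vector +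
  fixes scaleC :: "complex \<Rightarrow> 'a \<Rightarrow> 'a"  (infixr \<open>*\<^sub>C\<close> 75)
  assumes scaleC_add_right: "a *\<^sub>C (x + y) = a *\<^sub>C x + a *\<^sub>C y"
    and scaleC_add_left: "(a + b) *\<^sub>C x = a *\<^sub>C x + b *\<^sub>C x"
    and scaleC_scaleC: "a *\<^sub>C b *\<^sub>C x = (a * b) *\<^sub>C x"
    and scaleR_scaleC: "r *\<^sub>R x = complex_of_real r *\<^sub>C x"
    and norm_scaleC: "norm (a *\<^sub>C x) = cmod a * norm x"

class cbanach = complex_normed_vector + banach

lemma scaleC_one [simp]: "1 *\<^sub>C (x :: 'a::complex_normed_vector) = x"
  using scaleR_scaleC[of 1 x] by simp

global_interpretation complex_vector:
  vector_space "scaleC :: complex \<Rightarrow> 'a \<Rightarrow> 'a::complex_normed_vector"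
  defines cspan = complex_vector.span
    and csubspace = complex_vector.subspace
    and cdim = complex_vector.dim
  by unfold_locales (simp_all add: scaleC_add_right scaleC_add_left scaleC_scaleC)

instantiation complex :: cbanach
begin

definition scaleC_complex :: "complex \<Rightarrow> complex \<Rightarrow> complex"
  where "scaleC_complex a x = a * x"

instance
  by standard (simp_all add: scaleC_complex_def algebra_simps norm_mult scaleR_conv_of_real)

end

text \<open>The direct sum. The library norm on a product is
  \<open>sqrt ((norm x)^2 + (norm y)^2)\<close>, one of the usual equivalent norms.\<close>

instantiation prod :: (complex_normed_vector, complex_normed_vector) complex_normed_vector
begin

definition scaleC_prod :: "complex \<Rightarrow> 'a \<times> 'b \<Rightarrow> 'a \<times> 'b"
  where "scaleC_prod c z = (c *\<^sub>C fst z, c *\<^sub>C snd z)"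

instance
proof
  fix a b :: complex and r :: real and x y :: "'a \<times> 'b"
  show "a *\<^sub>C (x + y) = a *\<^sub>C x + a *\<^sub>C y"
    by (simp add: scaleC_prod_def scaleC_add_right)
  show "(a + b) *\<^sub>C x = a *\<^sub>C x + b *\<^sub>C x"
    by (simp add: scaleC_prod_def scaleC_add_left)
  show "a *\<^sub>C b *\<^sub>C x = (a * b) *\<^sub>C x"
    by (simp add: scaleC_prod_def scaleC_scaleC)
  show "r *\<^sub>R x = complex_of_real r *\<^sub>C x"
    by (simp add: scaleC_prod_def scaleR_scaleC scaleR_prod_def)
  show "norm (a *\<^sub>C x) = cmod a * norm x"
    by (simp add: scaleC_prod_def norm_prod_def norm_scaleC power_mult_distrib
        distrib_left[symmetric] real_sqrt_mult)
qed

end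

instance prod :: (cbanach, cbanach) cbanach ..

section \<open>Bounded complex-linear operators\<close>

definition bounded_clinear ::
    "('a::complex_normed_vector \<Rightarrow> 'b::complex_normed_vector) \<Rightarrow> bool"
  where "bounded_clinear f \<longleftrightarrow> bounded_linear f \<and> (\<forall>c x. f (c *\<^sub>C x) = c *\<^sub>C f x)"

typedef (overloaded) ('a, 'b) cblinfun (\<open>(_ \<Rightarrow>\<^sub>C\<^sub>L /_)\<close> [22, 21] 21) =
  "{f :: 'a::complex_normed_vector \<Rightarrow> 'b::complex_normed_vector. bounded_clinear f}"
  morphisms cblinfun_apply CBlinfun
  by (rule exI[of _ "\<lambda>_. 0"])
    (simp add: bounded_clinear_def complex_vector.scale_zero_right)

setup_lifting type_definition_cblinfun

notation cblinfun_apply (infixr \<open>*\<^sub>V\<close> 70)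

lemma cblinfun_eqI: "(\<And>x. f *\<^sub>V x = g *\<^sub>V x) \<Longrightarrow> f = g"
  by transfer auto

lemma bounded_linear_cblinfun_apply: "bounded_linear (cblinfun_apply f)"
  by transfer (simp add: bounded_clinear_def)

lemma cblinfun_apply_scaleC: "f *\<^sub>V (c *\<^sub>C x) = c *\<^sub>C (f *\<^sub>V x)"
  by transfer (simp add: bounded_clinear_def)

instantiation cblinfun :: (complex_normed_vector, complex_normed_vector) complex_normed_vector
begin

lift_definition norm_cblinfun :: "'a \<Rightarrow>\<^sub>C\<^sub>L 'b \<Rightarrow> real" is onorm .

lift_definition zero_cblinfun :: "'a \<Rightarrow>\<^sub>C\<^sub>L 'b" is "\<lambda>x. 0"
  by (simp add: bounded_clinear_def complex_vector.scale_zero_right)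

lift_definition plus_cblinfun :: "'a \<Rightarrow>\<^sub>C\<^sub>L 'b \<Rightarrow> 'a \<Rightarrow>\<^sub>C\<^sub>L 'b \<Rightarrow> 'a \<Rightarrow>\<^sub>C\<^sub>L 'b"
  is "\<lambda>f g x. f x + g x"
  by (simp add: bounded_clinear_def bounded_linear_add scaleC_add_right)

lift_definition minus_cblinfun :: "'a \<Rightarrow>\<^sub>C\<^sub>L 'b \<Rightarrow> 'a \<Rightarrow>\<^sub>C\<^sub>L 'b \<Rightarrow> 'a \<Rightarrow>\<^sub>C\<^sub>L 'b"
  is "\<lambda>f g x. f x - g x"
  by (simp add: bounded_clinear_def bounded_linear_sub complex_vector.scale_right_diff_distrib)

lift_definition uminus_cblinfun :: "'a \<Rightarrow>\<^sub>C\<^sub>L 'b \<Rightarrow> 'a \<Rightarrow>\<^sub>C\<^sub>L 'b" is "\<lambda>f x. - f x"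
  by (simp add: bounded_clinear_def bounded_linear_minus complex_vector.scale_minus_right)

lift_definition scaleC_cblinfun :: "complex \<Rightarrow> 'a \<Rightarrow>\<^sub>C\<^sub>L 'b \<Rightarrow> 'a \<Rightarrow>\<^sub>C\<^sub>L 'b"
  is "\<lambda>c f x. c *\<^sub>C f x"
proof -
  fix c :: complex and f :: "'a \<Rightarrow> 'b"
  assume f: "bounded_clinear f"
  have "bounded_linear (\<lambda>x::'b. c *\<^sub>C x)"
    by (rule bounded_linear_intro[where K = "cmod c"])
      (simp_all add: scaleC_add_right scaleR_scaleC scaleC_scaleC norm_scaleC mult.commute)
  then have "bounded_linear (\<lambda>x. c *\<^sub>C f x)"
    using f by (auto simp: bounded_clinear_def intro: bounded_linear_compose)
  then show "bounded_clinear (\<lambda>x. c *\<^sub>C f x)"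
    using f by (simp add: bounded_clinear_def scaleC_scaleC mult.commute)
qed

definition scaleR_cblinfun :: "real \<Rightarrow> 'a \<Rightarrow>\<^sub>C\<^sub>L 'b \<Rightarrow> 'a \<Rightarrow>\<^sub>C\<^sub>L 'b"
  where "scaleR_cblinfun r f = complex_of_real r *\<^sub>C f"

definition dist_cblinfun :: "'a \<Rightarrow>\<^sub>C\<^sub>L 'b \<Rightarrow> 'a \<Rightarrow>\<^sub>C\<^sub>L 'b \<Rightarrow> real"
  where "dist_cblinfun a b = norm (a - b)"

definition uniformity_cblinfun :: "(('a \<Rightarrow>\<^sub>C\<^sub>L 'b) \<times> ('a \<Rightarrow>\<^sub>C\<^sub>L 'b)) filter"
  where "uniformity_cblinfun = (INF e\<in>{0 <..}. principal {(x, y). dist x y < e})"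

definition open_cblinfun :: "('a \<Rightarrow>\<^sub>C\<^sub>L 'b) set \<Rightarrow> bool"
  where "open_cblinfun S \<longleftrightarrow> (\<forall>x\<in>S. \<forall>\<^sub>F (x', y) in uniformity. x' = x \<longrightarrow> y \<in> S)"

definition sgn_cblinfun :: "'a \<Rightarrow>\<^sub>C\<^sub>L 'b \<Rightarrow> 'a \<Rightarrow>\<^sub>C\<^sub>L 'b"
  where "sgn_cblinfun x = scaleR (inverse (norm x)) x"

instance
proof
  fix a b :: complex and r s :: real and f g h :: "'a \<Rightarrow>\<^sub>C\<^sub>L 'b"
  show "f + g + h = f + (g + h)"
    by transfer (simp add: add.assoc)
  show "f + g = g + f"
    by transfer (simp add: add.commute)
  show "0 + f = f"
    by transfer simp
  show "- f + f = 0"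
    by transfer simp
  show "f - g = f + - g"
    by transfer simp
  show "a *\<^sub>C (f + g) = a *\<^sub>C f + a *\<^sub>C g" for f g :: "'a \<Rightarrow>\<^sub>C\<^sub>L 'b"
    by transfer (simp add: scaleC_add_right)
  show "(a + b) *\<^sub>C f = a *\<^sub>C f + b *\<^sub>C f" for a b and f :: "'a \<Rightarrow>\<^sub>C\<^sub>L 'b"
    by transfer (simp add: scaleC_add_left)
  show "a *\<^sub>C b *\<^sub>C f = (a * b) *\<^sub>C f" for a b and f :: "'a \<Rightarrow>\<^sub>C\<^sub>L 'b"
    by transfer (simp add: scaleC_scaleC)
  show "r *\<^sub>R f = complex_of_real r *\<^sub>C f"
    by (simp add: scaleR_cblinfun_def)
  show "r *\<^sub>R (f + g) = r *\<^sub>R f + r *\<^sub>R g"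
    unfolding scaleR_cblinfun_def by transfer (simp add: scaleC_add_right)
  show "(r + s) *\<^sub>R f = r *\<^sub>R f + s *\<^sub>R f"
    unfolding scaleR_cblinfun_def by transfer (simp add: scaleC_add_left)
  show "r *\<^sub>R s *\<^sub>R f = (r * s) *\<^sub>R f"
    unfolding scaleR_cblinfun_def by transfer (simp add: scaleC_scaleC)
  show "1 *\<^sub>R f = f"
    unfolding scaleR_cblinfun_def by transfer simp
  show "sgn f = inverse (norm f) *\<^sub>R f" "dist f g = norm (f - g)"
    by (simp_all add: sgn_cblinfun_def dist_cblinfun_def)
  show "(uniformity :: (('a \<Rightarrow>\<^sub>C\<^sub>L 'b) \<times> ('a \<Rightarrow>\<^sub>C\<^sub>L 'b)) filter)
      = (INF e\<in>{0 <..}. principal {(x, y). dist x y < e})"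
    by (simp add: uniformity_cblinfun_def)
  show "open U \<longleftrightarrow> (\<forall>x\<in>U. \<forall>\<^sub>F (x', y) in uniformity. x' = x \<longrightarrow> y \<in> U)"
    for U :: "('a \<Rightarrow>\<^sub>C\<^sub>L 'b) set"
    by (simp add: open_cblinfun_def)
  show "norm f = 0 \<longleftrightarrow> f = 0"
    by transfer (auto simp: bounded_clinear_def onorm_eq_0)
  show "norm (f + g) \<le> norm f + norm g"
    by transfer (simp add: bounded_clinear_def onorm_triangle)
  show norm_C: "norm (a *\<^sub>C f) = cmod a * norm f" for a and f :: "'a \<Rightarrow>\<^sub>C\<^sub>L 'b"
  proof transfer
    fix a :: complex and f :: "'a \<Rightarrow> 'b"
    assume "bounded_clinear f"
    then have "onorm (\<lambda>x. cmod a *\<^sub>R f x) = \<bar>cmod a\<bar> * onorm f"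
      by (intro onorm_scaleR) (simp add: bounded_clinear_def)
    then show "onorm (\<lambda>x. a *\<^sub>C f x) = cmod a * onorm f"
      by (simp add: onorm_def norm_scaleC)
  qed
  show "norm (r *\<^sub>R f) = \<bar>r\<bar> * norm f"
    by (simp add: scaleR_cblinfun_def norm_C)
qed

end

instance cblinfun :: (complex_normed_vector, cbanach) cbanach
proof
  fix X :: "nat \<Rightarrow> 'a \<Rightarrow>\<^sub>C\<^sub>L 'b"
  assume X: "Cauchy X"
  define b where "b f = Blinfun (cblinfun_apply f)" for f :: "'a \<Rightarrow>\<^sub>C\<^sub>L 'b"
  have b: "blinfun_apply (b f) = cblinfun_apply f" for f
    unfolding b_def by (rule bounded_linear_Blinfun_apply[OF bounded_linear_cblinfun_apply])
  have dist_b: "dist (b f) (b g) = dist f g" for f g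
    by (simp add: dist_norm norm_blinfun.rep_eq norm_cblinfun.rep_eq minus_blinfun.rep_eq
        minus_cblinfun.rep_eq b)
  have "Cauchy (\<lambda>n. b (X n))"
    using X by (simp add: Cauchy_def dist_b)
  then obtain L where L: "(\<lambda>n. b (X n)) \<longlonglongrightarrow> L"
    using Cauchy_convergent_iff convergent_def by blast
  have lim: "(\<lambda>n. X n *\<^sub>V x) \<longlonglongrightarrow> blinfun_apply L x" for x
    using blinfun.tendsto[OF L tendsto_const[of x]] by (simp add: b)
  have "blinfun_apply L (c *\<^sub>C x) = c *\<^sub>C blinfun_apply L x" for c x
  proof -
    have "bounded_linear (\<lambda>x::'b. c *\<^sub>C x)"
      by (rule bounded_linear_intro[where K = "cmod c"])
        (simp_all add: scaleC_add_right scaleR_scaleC scaleC_scaleC norm_scaleC mult.commute)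
    from bounded_linear.tendsto[OF this lim[of x]] lim[of "c *\<^sub>C x"]
    show ?thesis
      by (simp add: cblinfun_apply_scaleC LIMSEQ_unique)
  qed
  then have "bounded_clinear (blinfun_apply L)"
    by (simp add: bounded_clinear_def blinfun.bounded_linear_right)
  then have "b (CBlinfun (blinfun_apply L)) = L"
    by (intro blinfun_eqI) (simp add: b CBlinfun_inverse)
  with L have "X \<longlonglongrightarrow> CBlinfun (blinfun_apply L)"
    by (simp add: tendsto_iff dist_b[symmetric])
  then show "convergent X"
    by (auto simp: convergent_def)
qed

lift_definition id_cblinfun :: "'a::complex_normed_vector \<Rightarrow>\<^sub>C\<^sub>L 'a" is "\<lambda>x. x"
  by (simp add: bounded_clinear_def)

lift_definition cblinfun_compose ::
    "'b::complex_normed_vector \<Rightarrow>\<^sub>C\<^sub>L 'c::complex_normed_vector \<Rightarrow>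
     'a::complex_normed_vector \<Rightarrow>\<^sub>C\<^sub>L 'b \<Rightarrow> 'a \<Rightarrow>\<^sub>C\<^sub>L 'c"  (infixl \<open>o\<^sub>C\<^sub>L\<close> 67)
  is "\<lambda>f g x. f (g x)"
  by (auto simp: bounded_clinear_def intro: bounded_linear_compose)

type_synonym 'a cdual = "'a \<Rightarrow>\<^sub>C\<^sub>L complex"

lift_definition dual_op ::
    "'a::complex_normed_vector \<Rightarrow>\<^sub>C\<^sub>L 'b::complex_normed_vector \<Rightarrow> 'b cdual \<Rightarrow>\<^sub>C\<^sub>L 'a cdual"
  is "\<lambda>T \<phi>. \<phi> o\<^sub>C\<^sub>L T"
proof -
  fix T :: "'a \<Rightarrow>\<^sub>C\<^sub>L 'b"
  have C: "(c *\<^sub>C \<phi>) o\<^sub>C\<^sub>L T = c *\<^sub>C (\<phi> o\<^sub>C\<^sub>L T)" for c and \<phi> :: "'b cdual"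
    by transfer simp
  have "bounded_linear (\<lambda>\<phi> :: 'b cdual. \<phi> o\<^sub>C\<^sub>L T)"
  proof (rule bounded_linear_intro[where K = "norm T"])
    fix \<phi> \<psi> :: "'b cdual" and r :: real
    show "(\<phi> + \<psi>) o\<^sub>C\<^sub>L T = \<phi> o\<^sub>C\<^sub>L T + \<psi> o\<^sub>C\<^sub>L T"
      by transfer simp
    show "(r *\<^sub>R \<phi>) o\<^sub>C\<^sub>L T = r *\<^sub>R (\<phi> o\<^sub>C\<^sub>L T)"
      by (simp add: scaleR_scaleC C)
    show "norm (\<phi> o\<^sub>C\<^sub>L T) \<le> norm \<phi> * norm T"
      by transfer (simp add: bounded_clinear_def onorm_compose[unfolded o_def])
  qed
  then show "bounded_clinear (\<lambda>\<phi> :: 'b cdual. \<phi> o\<^sub>C\<^sub>L T)"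
    by (simp add: bounded_clinear_def C)
qed

text \<open>The operator matrix with rows \<open>(A, C)\<close> and \<open>(0, B)\<close> on the direct sum.\<close>

lift_definition upper_tri_op ::
    "'x::complex_normed_vector \<Rightarrow>\<^sub>C\<^sub>L 'x \<Rightarrow> 'y::complex_normed_vector \<Rightarrow>\<^sub>C\<^sub>L 'x \<Rightarrow> 'y \<Rightarrow>\<^sub>C\<^sub>L 'y \<Rightarrow>
     ('x \<times> 'y) \<Rightarrow>\<^sub>C\<^sub>L ('x \<times> 'y)"
  is "\<lambda>A C B z. (A (fst z) + C (snd z), B (snd z))"
proof -
  fix A :: "'x \<Rightarrow> 'x" and C :: "'y \<Rightarrow> 'x" and B :: "'y \<Rightarrow> 'y"
  assume *: "bounded_clinear A" "bounded_clinear C" "bounded_clinear B"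
  have "bounded_linear (\<lambda>z :: 'x \<times> 'y. A (fst z))"
    using * by (simp add: bounded_clinear_def bounded_linear_compose[OF _ bounded_linear_fst])
  moreover have "bounded_linear (\<lambda>z :: 'x \<times> 'y. C (snd z))"
    "bounded_linear (\<lambda>z :: 'x \<times> 'y. B (snd z))"
    using * by (simp_all add: bounded_clinear_def bounded_linear_compose[OF _ bounded_linear_snd])
  ultimately have "bounded_linear (\<lambda>z. (A (fst z) + C (snd z), B (snd z)))"
    by (intro bounded_linear_Pair bounded_linear_add)
  with * show "bounded_clinear (\<lambda>z. (A (fst z) + C (snd z), B (snd z)))"
    by (simp add: bounded_clinear_def scaleC_prod_def scaleC_add_right)
qed

section \<open>Operator classes\<close>

text \<open>Dimension with value \<open>\<infinity>\<close> for infinite-dimensional subspaces; the library's dimension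
  function is \<open>0\<close> there.\<close>

definition ecdim :: "'a::complex_normed_vector set \<Rightarrow> enat"
  where "ecdim S = (if \<exists>F. finite F \<and> S \<subseteq> cspan F then enat (cdim S) else \<infinity>)"

definition op_ker :: "('a::complex_normed_vector \<Rightarrow>\<^sub>C\<^sub>L 'b::complex_normed_vector) \<Rightarrow> 'a set"
  where "op_ker T = {x. T *\<^sub>V x = 0}"

definition op_range :: "('a::complex_normed_vector \<Rightarrow>\<^sub>C\<^sub>L 'b::complex_normed_vector) \<Rightarrow> 'b set"
  where "op_range T = range (cblinfun_apply T)"

primrec op_power :: "('a::complex_normed_vector \<Rightarrow>\<^sub>C\<^sub>L 'a) \<Rightarrow> nat \<Rightarrow> 'a \<Rightarrow>\<^sub>C\<^sub>L 'a"
  where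
    "op_power T 0 = id_cblinfun"
  | "op_power T (Suc n) = T o\<^sub>C\<^sub>L op_power T n"

definition nullity :: "('a::complex_normed_vector \<Rightarrow>\<^sub>C\<^sub>L 'a) \<Rightarrow> enat"
  where "nullity T = ecdim (op_ker T)"

definition asc :: "('a::complex_normed_vector \<Rightarrow>\<^sub>C\<^sub>L 'a) \<Rightarrow> enat"
  where "asc T =
    (if \<exists>k. op_ker (op_power T k) = op_ker (op_power T (Suc k))
     then enat (LEAST k. op_ker (op_power T k) = op_ker (op_power T (Suc k))) else \<infinity>)"

definition complemented :: "'a::complex_normed_vector set \<Rightarrow> bool"
  where "complemented M \<longleftrightarrow>
    (\<exists>N. csubspace N \<and> closed N \<and> M \<inter> N = {0} \<and> {m + n | m n. m \<in> M \<and> n \<in> N} = UNIV)"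

definition \<Phi>_plus :: "('a::complex_normed_vector \<Rightarrow>\<^sub>C\<^sub>L 'a) set"
  where "\<Phi>_plus = {T. nullity T < \<infinity> \<and> closed (op_range T)}"

definition \<Phi>_l :: "('a::complex_normed_vector \<Rightarrow>\<^sub>C\<^sub>L 'a) set"
  where "\<Phi>_l = {T. closed (op_range T) \<and> complemented (op_range T) \<and> nullity T < \<infinity>}"

definition \<Phi>_ab :: "('a::complex_normed_vector \<Rightarrow>\<^sub>C\<^sub>L 'a) set"
  where "\<Phi>_ab = {T \<in> \<Phi>_plus. asc T < \<infinity>}"

definition \<Phi>_lb :: "('a::complex_normed_vector \<Rightarrow>\<^sub>C\<^sub>L 'a) set"
  where "\<Phi>_lb = {T \<in> \<Phi>_l. asc T < \<infinity>}"

definition left_invertible :: "('a::complex_normed_vector \<Rightarrow>\<^sub>C\<^sub>L 'a) \<Rightarrow> bool"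
  where "left_invertible T \<longleftrightarrow> (\<exists>S :: 'a \<Rightarrow>\<^sub>C\<^sub>L 'a. S o\<^sub>C\<^sub>L T = id_cblinfun)"

section \<open>Spectra\<close>

definition \<sigma>_l :: "('a::complex_normed_vector \<Rightarrow>\<^sub>C\<^sub>L 'a) \<Rightarrow> complex set"
  where "\<sigma>_l T = {z. \<not> left_invertible (T - z *\<^sub>C id_cblinfun)}"

definition \<sigma>_lb :: "('a::complex_normed_vector \<Rightarrow>\<^sub>C\<^sub>L 'a) \<Rightarrow> complex set"
  where "\<sigma>_lb T = {z. T - z *\<^sub>C id_cblinfun \<notin> \<Phi>_lb}"

definition \<sigma>_ab :: "('a::complex_normed_vector \<Rightarrow>\<^sub>C\<^sub>L 'a) \<Rightarrow> complex set"
  where "\<sigma>_ab T = {z. T - z *\<^sub>C id_cblinfun \<notin> \<Phi>_ab}"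

definition \<sigma>_le :: "('a::complex_normed_vector \<Rightarrow>\<^sub>C\<^sub>L 'a) \<Rightarrow> complex set"
  where "\<sigma>_le T = {z. T - z *\<^sub>C id_cblinfun \<notin> \<Phi>_l}"

definition \<sigma>_SF_plus :: "('a::complex_normed_vector \<Rightarrow>\<^sub>C\<^sub>L 'a) \<Rightarrow> complex set"
  where "\<sigma>_SF_plus T = {z. T - z *\<^sub>C id_cblinfun \<notin> \<Phi>_plus}"

section \<open>The single valued extension property\<close>

text \<open>Analyticity of vector-valued functions of a complex variable, in the style of the
  library's \<open>analytic_on\<close>: near each point of \<open>S\<close> the difference quotients
  converge in norm.\<close>

definition vec_analytic_on :: "(complex \<Rightarrow> 'a::complex_normed_vector) \<Rightarrow> complex set \<Rightarrow> bool"
  where "vec_analytic_on f S \<longleftrightarrow>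
    (\<forall>z\<in>S. \<exists>e>0. \<forall>w\<in>ball z e. \<exists>D.
       ((\<lambda>v. inverse (v - w) *\<^sub>C (f v - f w)) \<longlongrightarrow> D) (at w))"

definition SVEP_at :: "('a::complex_normed_vector \<Rightarrow>\<^sub>C\<^sub>L 'a) \<Rightarrow> complex \<Rightarrow> bool"
  where "SVEP_at T z \<longleftrightarrow>
    (\<exists>r>0. \<forall>V. open V \<and> V \<subseteq> ball z r \<longrightarrow>
      (\<forall>f. vec_analytic_on f V \<and> (\<forall>\<mu>\<in>V. (T - \<mu> *\<^sub>C id_cblinfun) *\<^sub>V f \<mu> = 0)
         \<longrightarrow> (\<forall>\<mu>\<in>V. f \<mu> = 0)))"

definition SVEP_fail :: "('a::complex_normed_vector \<Rightarrow>\<^sub>C\<^sub>L 'a) \<Rightarrow> complex set"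
  where "SVEP_fail T = {z. \<not> SVEP_at T z}"

end

theory Submission
  imports Defs
begin

text \<open>
  Fix \<open>z\<close> at which the dual of \<open>A\<close> has the SVEP. Subtracting \<open>z\<close> from the operator matrix subtracts it
  from both diagonal entries, so it suffices to compare \<open>M\<close>, \<open>A\<close> and \<open>B\<close> (already shifted by \<open>z\<close>) and
  to see that \<open>M\<close> lies in an operator class iff \<open>A\<close> and \<open>B\<close> do.

  For each class there are three implications. Two of them are formal once the classes have a flexible
  description: an operator \<open>T\<close> is in \<open>\<Phi>_plus\<close> iff it satisfies
  \<open>norm x \<le> K * norm (T x) + L * norm (F x)\<close> with \<open>F\<close> of finite rank
  (\<open>\<Phi>_plus_estimate\<close>, \<open>\<Phi>_plus_of_estimate\<close>), and in \<open>\<Phi>_l\<close> iff it has a left inverse modulo finite rank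
  (\<open>\<Phi>_l_regularizer\<close>, \<open>\<Phi>_l_of_regularizer\<close>). Estimates and left inverses for \<open>A\<close> and \<open>B\<close> combine to one
  for \<open>M\<close>, and one for \<open>M\<close> restricts to the first summand. Ascents behave in the same way.

  The step that needs the SVEP is the passage from \<open>M\<close> to \<open>B\<close>. It works when \<open>A\<close> has a right inverse
  \<open>S\<close> modulo finite rank: the vector \<open>(- S (C y), y)\<close> is sent by \<open>M\<close> to \<open>(0, B y)\<close> up to finite rank, so
  \<open>B\<close> is controlled by \<open>M\<close>. For left inverses \<open>A\<close> has to be surjective instead, and the ascent of \<open>B\<close> is
  controlled by that of \<open>M\<close> when \<open>A\<close> has finite descent (\<open>asc_upper_tri_snd\<close>). All this is available:
  \<open>S\<close> exists, the descent is finite, and \<open>A\<close> is surjective if it is injective, because for some \<open>m\<close> the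
  whole space is the sum of the range of \<open>A\<close> and the kernel of \<open>A^m\<close>
  (\<open>range_plus_ker_power_of_dual_SVEP\<close>).

  To see the latter, let \<open>L\<close> be the sum of the range of \<open>A\<close> and of the kernels of all powers of \<open>A\<close>.
  Because the kernel of \<open>A\<close> is finite-dimensional, one power suffices, and \<open>L\<close> is closed. If \<open>L\<close> were proper, some
  nonzero functional \<open>\<phi>0\<close> would vanish on \<open>L\<close>. Every functional that vanishes on all kernels of powers is
  \<open>\<psi> o A\<close> for another such functional \<open>\<psi>\<close>, with a uniform norm bound (open mapping theorem and
  Hahn--Banach extension). Iterating from \<open>\<phi>0\<close> gives \<open>\<phi>1, \<phi>2, ...\<close> of at most geometric growth, each
  mapped to its predecessor by the dual of the shifted operator, and \<open>\<phi>0\<close> to \<open>0\<close>. The sum of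
  \<open>(\<mu> - z)^n \<phi>n\<close> is then an analytic function of \<open>\<mu>\<close>, nonzero at \<open>z\<close>, that is annihilated by the dual of
  the unshifted operator minus \<open>\<mu>\<close>, against the SVEP.
\<close>

section \<open>Hahn--Banach extension of real functionals\<close>

text \<open>A partial linear functional is represented by its graph, a subspace of the product with the reals. The bound
\<open>t \<le> k * norm x\<close> on a subspace already makes it single-valued, since it forces \<open>t = 0\<close> where \<open>x = 0\<close>; so
extension of functionals is just enlargement of dominated subspaces. This is the one-dimensional step.\<close>

lemma dominated_graph_extend:
  fixes H :: "('a::real_normed_vector \<times> real) set"
  assumes H: "subspace H" and dom: "\<And>x t. (x, t) \<in> H \<Longrightarrow> t \<le> k * norm x" and k: "0 \<le> k"
  obtains c where "\<And>x t. (x, t) \<in> span (insert (x0, c) H) \<Longrightarrow> t \<le> k * norm x"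
proof -
  \<comment> \<open>Every lower bound that the value at the new vector must respect is below every upper bound.\<close>
  have sep: "t - k * norm (x - x0) \<le> k * norm (y + x0) - s" if "(x, t) \<in> H" "(y, s) \<in> H" for x t y s
  proof -
    have "(x + y, t + s) \<in> H"
      using subspace_add[OF H that] by simp
    then have "t + s \<le> k * norm (x + y)"
      by (rule dom)
    also have "\<dots> \<le> k * (norm (x - x0) + norm (y + x0))"
      using norm_triangle_ineq[of "x - x0" "y + x0"] k by (simp add: mult_left_mono)
    finally show ?thesis
      by (simp add: algebra_simps)
  qed
  define L where "L = (\<lambda>(x, t). t - k * norm (x - x0)) ` H"
  define c where "c = Sup L"
  have 0: "(0, 0) \<in> H"
    using subspace_0[OF H] by (simp add: zero_prod_def)
  have "L \<noteq> {}"
    using 0 by (auto simp: L_def)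
  have "bdd_above L"
    by (rule bdd_aboveI[where M = "k * norm (0 + x0) - 0"]) (use sep[OF _ 0] in \<open>auto simp: L_def\<close>)
  have lower: "t - k * norm (x - x0) \<le> c" if "(x, t) \<in> H" for x t
    unfolding c_def by (rule cSup_upper[OF _ \<open>bdd_above L\<close>]) (use that in \<open>force simp: L_def\<close>)
  have upper: "c \<le> k * norm (y + x0) - s" if "(y, s) \<in> H" for y s
    unfolding c_def by (rule cSup_least[OF \<open>L \<noteq> {}\<close>]) (use sep[OF _ that] in \<open>auto simp: L_def\<close>)
  show thesis
  proof
    fix x t assume "(x, t) \<in> span (insert (x0, c) H)"
    then obtain r where "(x, t) - r *\<^sub>R (x0, c) \<in> span H"
      by (auto simp: span_breakdown_eq)
    then have r: "(x - r *\<^sub>R x0, t - r * c) \<in> H"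
      using H by (simp add: span_eq_iff[THEN iffD2])
    \<comment> \<open>Dividing by the coefficient of the new vector reduces to coefficient 1 or -1, where the two bounds apply.\<close>
    consider "r = 0" | "r > 0" | "r < 0"
      by linarith
    then show "t \<le> k * norm x"
    proof cases
      case 1
      then show ?thesis using r dom by simp
    next
      case 2
      have "((1 / r) *\<^sub>R (x - r *\<^sub>R x0), (1 / r) * (t - r * c)) \<in> H"
        using subspace_scale[OF H r, of "1 / r"] by simp
      from upper[OF this] have "c \<le> k * norm ((1 / r) *\<^sub>R x) - (1 / r) * (t - r * c)"
        using 2 by (simp add: scaleR_diff_right)
      then have "0 \<le> k * (norm x / r) - t / r"
        using 2 by (simp add: diff_divide_distrib)
      then show ?thesis
        using 2 by (simp add: field_simps)
    next
      case 3
      have "((- 1 / r) *\<^sub>R (x - r *\<^sub>R x0), (- 1 / r) * (t - r * c)) \<in> H"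
        using subspace_scale[OF H r, of "- 1 / r"] by simp
      from lower[OF this] have "(- 1 / r) * (t - r * c) - k * norm ((- 1 / r) *\<^sub>R x) \<le> c"
        using 3 by (simp add: scaleR_diff_right)
      then have "- t / r - k * (norm x / (- r)) \<le> 0"
        using 3 by (simp add: diff_divide_distrib)
      then show ?thesis
        using 3 by (simp add: field_simps)
    qed
  qed
qed

text \<open>A dominated subspace that is maximal by Zorn's lemma has full domain, by the one-dimensional step.\<close>

lemma real_hahn_banach:
  fixes G :: "('a::real_normed_vector \<times> real) set"
  assumes G: "subspace G" and dom: "\<And>x t. (x, t) \<in> G \<Longrightarrow> t \<le> k * norm x" and k: "0 \<le> k"
  obtains u where "linear u" "\<And>x t. (x, t) \<in> G \<Longrightarrow> u x = t" "\<And>x. \<bar>u x\<bar> \<le> k * norm x"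
proof -
  define \<A> where "\<A> = {H. subspace H \<and> G \<subseteq> H \<and> (\<forall>(x, t) \<in> H. t \<le> k * norm x)}"
  have "\<exists>M\<in>\<A>. \<forall>X\<in>\<A>. M \<subseteq> X \<longrightarrow> X = M"
  proof (rule subset_Zorn_nonempty)
    show "\<A> \<noteq> {}"
      using G dom by (auto simp: \<A>_def)
    fix \<C> assume ne: "\<C> \<noteq> {}" and ch: "subset.chain \<A> \<C>"
    have sub: "\<C> \<subseteq> \<A>" and tot: "\<And>X Y. X \<in> \<C> \<Longrightarrow> Y \<in> \<C> \<Longrightarrow> X \<subseteq> Y \<or> Y \<subseteq> X"
      using ch by (auto simp: subset.chain_def)
    have "subspace (\<Union>\<C>)"
    proof (rule subspaceI)
      show "0 \<in> \<Union>\<C>"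
        using ne sub subspace_0 by (fastforce simp: \<A>_def)
      show "x + y \<in> \<Union>\<C>" if xy: "x \<in> \<Union>\<C>" "y \<in> \<Union>\<C>" for x y
      proof -
        obtain X Y where "X \<in> \<C>" "x \<in> X" "Y \<in> \<C>" "y \<in> Y"
          using xy by blast
        with tot[of X Y] obtain Z where "Z \<in> \<C>" "x \<in> Z" "y \<in> Z"
          by blast
        with sub show ?thesis
          by (auto simp: \<A>_def intro: subspace_add)
      qed
      show "c *\<^sub>R x \<in> \<Union>\<C>" if "x \<in> \<Union>\<C>" for c x
        using that sub by (auto simp: \<A>_def intro: subspace_scale)
    qed
    then show "\<Union>\<C> \<in> \<A>"
      using ne sub by (auto simp: \<A>_def)
  qed
  then obtain H where "H \<in> \<A>" and max: "\<And>X. X \<in> \<A> \<Longrightarrow> H \<subseteq> X \<Longrightarrow> X = H"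
    by blast
  then have H: "subspace H" "G \<subseteq> H" and domH: "\<And>x t. (x, t) \<in> H \<Longrightarrow> t \<le> k * norm x"
    by (auto simp: \<A>_def)
  have total: "\<exists>c. (x, c) \<in> H" for x
  proof -
    obtain c where "\<And>y t. (y, t) \<in> span (insert (x, c) H) \<Longrightarrow> t \<le> k * norm y"
      using dominated_graph_extend[OF H(1) domH k] by blast
    then have "span (insert (x, c) H) \<in> \<A>"
      using H span_superset[of "insert (x, c) H"] by (auto simp: \<A>_def subspace_span)
    then have "span (insert (x, c) H) = H"
      using max span_superset[of "insert (x, c) H"] by blast
    then show ?thesis
      using span_superset[of "insert (x, c) H"] by blast
  qed
  have unique: "t = s" if "(x, t) \<in> H" "(x, s) \<in> H" for x t s
    using domH[of 0 "t - s"] domH[of 0 "s - t"]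
      subspace_diff[OF H(1) that] subspace_diff[OF H(1) that(2) that(1)] by simp
  define u where "u x = (THE t. (x, t) \<in> H)" for x
  have u: "(x, u x) \<in> H" for x
    unfolding u_def using total[of x] unique by (auto intro: theI)
  have ueq: "u x = t" if "(x, t) \<in> H" for x t
    using unique[OF u that] .
  have lin: "linear u"
  proof (rule linearI)
    show "u (x + y) = u x + u y" for x y
      by (rule ueq) (use subspace_add[OF H(1) u[of x] u[of y]] in simp)
    show "u (c *\<^sub>R x) = c *\<^sub>R u x" for c x
      by (rule ueq) (use subspace_scale[OF H(1) u[of x], of c] in simp)
  qed
  have "\<bar>u x\<bar> \<le> k * norm x" for x
    using domH[OF u[of x]] domH[OF u[of "- x"]] by (simp add: linear_neg[OF lin] abs_le_iff)
  then show thesis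
    using that lin ueq H(2) by blast
qed

section \<open>The open mapping theorem for closed subspaces\<close>

text \<open>The Baire category half of the open mapping theorem: the closures of the images of balls cover the closed,
hence completely metrizable, image, so one of them has interior there. A small vector is
the difference of two points of that interior, hence approximately the image of a difference of two vectors from the ball.\<close>

lemma approximate_preimage:
  fixes f :: "'a::banach \<Rightarrow> 'b::banach"
  assumes f: "bounded_linear f" and U: "subspace U" and cl: "closed (f ` U)"
  obtains c where "0 \<le> c"
    "\<And>z. z \<in> f ` U \<Longrightarrow> \<exists>x\<in>U. norm x \<le> c * norm z \<and> norm (z - f x) \<le> norm z / 2"
proof -
  interpret f: bounded_linear f by fact
  define Z where "Z = f ` U"
  define E where "E n = Z \<inter> closure (f ` (U \<inter> cball 0 (real n)))" for n :: nat
  have Z: "subspace Z" "closed Z"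
    using U cl by (auto simp: Z_def intro: f.linear_axioms linear_subspace_image)
  have cover: "\<Union>(range E) = Z"
  proof -
    have "z \<in> \<Union>(range E)" if z: "z \<in> Z" for z
    proof -
      obtain x where x: "x \<in> U" "z = f x"
        using z by (auto simp: Z_def)
      obtain n where "norm x \<le> real n"
        using real_arch_simple by blast
      then have "f x \<in> f ` (U \<inter> cball 0 (real n))"
        using x by auto
      then have "f x \<in> closure (f ` (U \<inter> cball 0 (real n)))"
        by (rule subsetD[OF closure_subset])
      then show ?thesis
        using z x by (auto simp: E_def)
    qed
    then show ?thesis
      by (auto simp: E_def)
  qed
  have comp: "completely_metrizable_space (top_of_set Z)"
    using completely_metrizable_space_closedin[OF completely_metrizable_space_euclidean] Z by simp
  have "\<exists>n. top_of_set Z interior_of E n \<noteq> {}"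
  proof (rule ccontr)
    assume none: "\<not> ?thesis"
    have "top_of_set Z interior_of \<Union>(range E) = {}"
    proof (rule Baire_category_alt)
      show "completely_metrizable_space (top_of_set Z) \<or>
          locally_compact_space (top_of_set Z) \<and> regular_space (top_of_set Z)"
        using comp by blast
      show "countable (range E)"
        by simp
      show "closedin (top_of_set Z) T \<and> top_of_set Z interior_of T = {}" if "T \<in> range E" for T
        using that none by (auto simp: E_def closedin_closed)
    qed
    moreover have "top_of_set Z interior_of \<Union>(range E) = Z"
      unfolding cover using interior_of_topspace[of "top_of_set Z"] by simp
    ultimately show False
      using subspace_0[OF Z(1)] by simp
  qed
  then obtain n z0 where "z0 \<in> top_of_set Z interior_of E n"
    by blast
  then obtain V where V: "openin (top_of_set Z) V" "z0 \<in> V" "V \<subseteq> E n"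
    by (auto simp: interior_of_def)
  have z0: "z0 \<in> Z"
    using V by (auto simp: E_def)
  obtain e where e: "e > 0" "ball z0 e \<inter> Z \<subseteq> V"
    using V(1,2) unfolding openin_contains_ball by blast
  \<comment> \<open>The vector \<open>z\<close> is scaled to norm \<open>e / 2\<close> and approximated by a difference of two vectors of norm at most \<open>n\<close>.\<close>
  define c where "c = 4 * real n / e"
  show thesis
  proof
    show "0 \<le> c"
      using e by (simp add: c_def)
    fix z assume "z \<in> f ` U"
    then have z: "z \<in> Z"
      by (simp add: Z_def)
    show "\<exists>x\<in>U. norm x \<le> c * norm z \<and> norm (z - f x) \<le> norm z / 2"
    proof (cases "z = 0")
      case True
      then show ?thesis
        using subspace_0[OF U] by (intro bexI[of _ 0]) auto
    next
      case False
      define a where "a = e / (2 * norm z)"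
      have a: "a > 0"
        using e False by (simp add: a_def)
      have "z0 + a *\<^sub>R z \<in> ball z0 e \<inter> Z"
        using e False z z0 Z(1) by (auto simp: a_def dist_norm subspace_add subspace_scale)
      then have 1: "z0 + a *\<^sub>R z \<in> closure (f ` (U \<inter> cball 0 (real n)))"
        using e(2) V by (auto simp: E_def)
      have 2: "z0 \<in> closure (f ` (U \<inter> cball 0 (real n)))"
        using V by (auto simp: E_def)
      define d where "d = a * norm z / 4"
      have d: "d > 0"
        using a False by (simp add: d_def)
      obtain x1 where x1: "x1 \<in> U" "norm x1 \<le> real n" "norm (f x1 - (z0 + a *\<^sub>R z)) < d"
        using 1 d by (force simp: closure_approachable dist_norm)
      obtain x2 where x2: "x2 \<in> U" "norm x2 \<le> real n" "norm (f x2 - z0) < d"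
        using 2 d by (force simp: closure_approachable dist_norm)
      define x where "x = (1 / a) *\<^sub>R (x1 - x2)"
      have "x \<in> U"
        using U x1 x2 by (simp add: x_def subspace_diff subspace_scale)
      moreover have "norm x \<le> c * norm z"
      proof -
        have "norm (x1 - x2) \<le> 2 * real n"
          using norm_triangle_ineq4[of x1 x2] x1 x2 by linarith
        then have "norm x \<le> (1 / a) * (2 * real n)"
          using a by (simp add: x_def divide_right_mono)
        also have "\<dots> = c * norm z"
          by (simp add: a_def c_def)
        finally show ?thesis .
      qed
      moreover have "norm (z - f x) \<le> norm z / 2"
      proof -
        have "z - f x = (1 / a) *\<^sub>R ((f x2 - z0) - (f x1 - (z0 + a *\<^sub>R z)))"
          using a by (simp add: x_def f.scaleR f.diff scaleR_diff_right scaleR_add_right)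
        then have "norm (z - f x) = (1 / a) * norm ((f x2 - z0) - (f x1 - (z0 + a *\<^sub>R z)))"
          using a by simp
        also have "\<dots> \<le> (1 / a) * (d + d)"
          using norm_triangle_ineq4[of "f x2 - z0" "f x1 - (z0 + a *\<^sub>R z)"] x1(3) x2(3) a
          by (intro mult_left_mono) auto
        also have "\<dots> = norm z / 2"
          using a by (simp add: d_def)
        finally show ?thesis .
      qed
      ultimately show ?thesis
        by blast
    qed
  qed
qed

text \<open>Successive approximation: the errors halve at each step, so the corrections sum to an exact preimage.\<close>

lemma open_mapping_closed_range:
  fixes f :: "'a::banach \<Rightarrow> 'b::banach"
  assumes f: "bounded_linear f" and U: "subspace U" "closed U" and cl: "closed (f ` U)"
  obtains K where "0 \<le> K" "\<And>z. z \<in> f ` U \<Longrightarrow> \<exists>x\<in>U. f x = z \<and> norm x \<le> K * norm z"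
proof -
  interpret f: bounded_linear f by fact
  obtain c where c: "0 \<le> c"
    "\<And>z. z \<in> f ` U \<Longrightarrow> \<exists>x\<in>U. norm x \<le> c * norm z \<and> norm (z - f x) \<le> norm z / 2"
    using approximate_preimage[OF f U(1) cl] by blast
  then obtain g where g: "\<And>z. z \<in> f ` U \<Longrightarrow> g z \<in> U"
    "\<And>z. z \<in> f ` U \<Longrightarrow> norm (g z) \<le> c * norm z"
    "\<And>z. z \<in> f ` U \<Longrightarrow> norm (z - f (g z)) \<le> norm z / 2"
    by metis
  have Z: "subspace (f ` U)"
    using U(1) by (intro linear_subspace_image f.linear_axioms)
  show thesis
  proof
    show "0 \<le> 2 * c"
      using c by simp
    fix z assume z: "z \<in> f ` U"
    \<comment> \<open>The error left after \<open>k\<close> corrections.\<close>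
    define r where "r k = ((\<lambda>y. y - f (g y)) ^^ k) z" for k
    have r0: "r 0 = z" and rS: "r (Suc k) = r k - f (g (r k))" for k
      by (simp_all add: r_def)
    have rU: "r k \<in> f ` U" for k
      by (induction k) (use z g(1) in \<open>simp_all add: r0 rS subspace_diff[OF Z]\<close>)
    have rn: "norm (r k) \<le> norm z * (1 / 2) ^ k" for k
    proof (induction k)
      case (Suc k)
      then show ?case
        using g(3)[OF rU[of k]] by (simp add: rS)
    qed (simp add: r0)
    define x where "x k = g (r k)" for k
    have xU: "x k \<in> U" for k
      unfolding x_def by (rule g(1)[OF rU])
    have xn: "norm (x k) \<le> (c * norm z) * (1 / 2) ^ k" for k
      using g(2)[OF rU[of k]] mult_left_mono[OF rn[of k] c(1)] by (simp add: x_def mult.assoc)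
    have geo: "summable (\<lambda>k. (c * norm z) * (1 / 2 :: real) ^ k)"
      by (simp add: summable_mult)
    have sumn: "summable (\<lambda>k. norm (x k))"
      by (rule summable_comparison_test'[OF geo]) (use xn in auto)
    then have sumx: "summable x"
      by (rule summable_norm_cancel)
    have "suminf x \<in> U"
      using U(2) subspace_sum[OF U(1) xU] summable_LIMSEQ[OF sumx]
      by (rule closed_sequentially)
    moreover have "f (suminf x) = z"
    proof -
      have tel: "f (\<Sum>k<n. x k) = z - r n" for n
        by (induction n) (simp_all add: r0 rS f.add x_def)
      have "(\<lambda>n. norm z * (1 / 2 :: real) ^ n) \<longlonglongrightarrow> norm z * 0"
        by (intro tendsto_intros) simp
      then have "r \<longlonglongrightarrow> 0"
        by (intro Lim_null_comparison[of r]) (use rn in auto)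
      then have "(\<lambda>n. z - r n) \<longlonglongrightarrow> z - 0"
        by (intro tendsto_intros)
      moreover have "(\<lambda>n. f (\<Sum>k<n. x k)) \<longlonglongrightarrow> f (suminf x)"
        by (rule f.tendsto[OF summable_LIMSEQ[OF sumx]])
      ultimately show ?thesis
        unfolding tel by (simp add: LIMSEQ_unique)
    qed
    moreover have "norm (suminf x) \<le> 2 * c * norm z"
    proof -
      have "norm (suminf x) \<le> (\<Sum>k. norm (x k))"
        by (rule summable_norm[OF sumn])
      also have "\<dots> \<le> (\<Sum>k. (c * norm z) * (1 / 2) ^ k)"
        by (rule suminf_le[OF xn sumn geo])
      also have "\<dots> = 2 * c * norm z"
        using suminf_mult[of "\<lambda>k. (1 / 2 :: real) ^ k" "c * norm z"] suminf_geometric[of "1 / 2 :: real"]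
        by (simp add: summable_geometric)
      finally show ?thesis .
    qed
    ultimately show "\<exists>x\<in>U. f x = z \<and> norm x \<le> 2 * c * norm z"
      by blast
  qed
qed

section \<open>Bounded complex-linear maps\<close>

text \<open>Auxiliary maps such as projections and inverses modulo finite rank are handled as plain functions satisfying
\<open>bounded_clinear\<close>, which avoids an algebra of operators between various sums of spaces. The rules below
derive this property from the shape of a term.\<close>

lemma bounded_clinear_cblinfun_apply: "bounded_clinear (cblinfun_apply f)"
  using cblinfun_apply[of f] by simp

lemma bounded_clinear_ident: "bounded_clinear (\<lambda>x. x)"
  by (simp add: bounded_clinear_def)

lemma bounded_clinear_zero: "bounded_clinear (\<lambda>x. 0)"
  by (simp add: bounded_clinear_def complex_vector.scale_zero_right)

lemma bounded_clinear_add: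
  "bounded_clinear f \<Longrightarrow> bounded_clinear g \<Longrightarrow> bounded_clinear (\<lambda>x. f x + g x)"
  by (simp add: bounded_clinear_def bounded_linear_add scaleC_add_right)

lemma bounded_clinear_diff:
  "bounded_clinear f \<Longrightarrow> bounded_clinear g \<Longrightarrow> bounded_clinear (\<lambda>x. f x - g x)"
  by (simp add: bounded_clinear_def bounded_linear_sub complex_vector.scale_right_diff_distrib)

lemma bounded_clinear_minus: "bounded_clinear f \<Longrightarrow> bounded_clinear (\<lambda>x. - f x)"
  by (simp add: bounded_clinear_def bounded_linear_minus complex_vector.scale_minus_right)

lemma bounded_clinear_compose:
  "bounded_clinear f \<Longrightarrow> bounded_clinear g \<Longrightarrow> bounded_clinear (\<lambda>x. f (g x))"
  by (simp add: bounded_clinear_def bounded_linear_compose)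

lemma bounded_clinear_Pair:
  "bounded_clinear f \<Longrightarrow> bounded_clinear g \<Longrightarrow> bounded_clinear (\<lambda>x. (f x, g x))"
  by (simp add: bounded_clinear_def bounded_linear_Pair scaleC_prod_def)

lemma bounded_clinear_fst: "bounded_clinear f \<Longrightarrow> bounded_clinear (\<lambda>x. fst (f x))"
  by (simp add: bounded_clinear_def bounded_linear_fst_comp scaleC_prod_def)

lemma bounded_clinear_snd: "bounded_clinear f \<Longrightarrow> bounded_clinear (\<lambda>x. snd (f x))"
  by (simp add: bounded_clinear_def bounded_linear_snd_comp scaleC_prod_def)

lemmas bounded_clinear_intros =
  bounded_clinear_cblinfun_apply bounded_clinear_ident bounded_clinear_zero bounded_clinear_add
  bounded_clinear_diff bounded_clinear_minus bounded_clinear_Pair bounded_clinear_fst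
  bounded_clinear_snd bounded_clinear_compose[OF bounded_clinear_cblinfun_apply]

lemma bounded_linear_scaleC_right: "bounded_linear (\<lambda>x. c *\<^sub>C (x :: 'a::complex_normed_vector))"
  by (rule bounded_linear_intro[where K = "cmod c"])
    (simp_all add: scaleC_add_right scaleR_scaleC scaleC_scaleC norm_scaleC mult.commute)

lemma bounded_clinear_scaleC_vector:
  assumes "bounded_clinear \<phi>"
  shows "bounded_clinear (\<lambda>x. \<phi> x *\<^sub>C v)"
proof -
  have "bounded_linear (\<lambda>c. c *\<^sub>C v)"
    by (rule bounded_linear_intro[where K = "norm v"])
      (simp_all add: scaleC_add_left scaleR_scaleC scaleC_scaleC norm_scaleC scaleC_complex_def)
  then have "bounded_linear (\<lambda>x. \<phi> x *\<^sub>C v)"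
    using assms by (auto simp: bounded_clinear_def intro: bounded_linear_compose)
  then show ?thesis
    using assms by (simp add: bounded_clinear_def scaleC_scaleC scaleC_complex_def)
qed

lemma bounded_clinearD:
  assumes "bounded_clinear f"
  shows "f (x + y) = f x + f y" "f (x - y) = f x - f y" "f (- x) = - f x" "f 0 = 0"
    "f (c *\<^sub>C x) = c *\<^sub>C f x"
proof -
  interpret bounded_linear f
    using assms by (simp add: bounded_clinear_def)
  show "f (x + y) = f x + f y" "f (x - y) = f x - f y" "f (- x) = - f x" "f 0 = 0"
    by (simp_all add: add diff neg zero)
  show "f (c *\<^sub>C x) = c *\<^sub>C f x"
    using assms by (simp add: bounded_clinear_def)
qed

lemmas cblinfun_linear = bounded_clinearD[OF bounded_clinear_cblinfun_apply]

lemma bounded_clinear_bound: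
  assumes "bounded_clinear f"
  obtains K where "0 \<le> K" "\<And>x. norm (f x) \<le> K * norm x"
  using assms bounded_linear.nonneg_bounded[of f] by (auto simp: bounded_clinear_def mult.commute)

lemma bounded_clinear_continuous: "bounded_clinear f \<Longrightarrow> continuous_on S f"
  using bounded_linear.continuous_on[of f S "\<lambda>x. x"] by (simp add: bounded_clinear_def)

lemma closed_bounded_clinear_vimage:
  assumes "bounded_clinear f" "closed S"
  shows "closed {x. f x \<in> S}"
  using closed_vimage[OF assms(2) bounded_clinear_continuous[OF assms(1)]] by (simp add: vimage_def)

lemma bounded_clinear_module_hom: "bounded_clinear f \<Longrightarrow> module_hom scaleC scaleC f"
  by (simp add: module_hom_iff bounded_clinearD complex_vector.module_axioms)

lemma bounded_clinear_span_image: "bounded_clinear f \<Longrightarrow> cspan (f ` W) = f ` cspan W"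
  unfolding cspan_def using module_hom.span_image[OF bounded_clinear_module_hom] by blast

lemma csubspace_imp_subspace: "csubspace S \<Longrightarrow> subspace S"
  by (simp add: subspace_def complex_vector.subspace_def scaleR_scaleC)

lemma csubspace_image:
  assumes f: "bounded_clinear f" and S: "csubspace S"
  shows "csubspace (f ` S)"
proof -
  have "f ` S = cspan (f ` S)"
    using S by (simp add: bounded_clinear_span_image[OF f] complex_vector.span_eq_iff[THEN iffD2])
  then show ?thesis
    using complex_vector.subspace_span by metis
qed

lemma csubspace_preimage:
  assumes "bounded_clinear f" "csubspace S"
  shows "csubspace {x. f x \<in> S}"
  using assms(2) by (simp add: complex_vector.subspace_def bounded_clinearD[OF assms(1)])

lemma csubspace_kernel: "bounded_clinear f \<Longrightarrow> csubspace {x. f x = 0}"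
  using csubspace_preimage[of f "{0}"] by (simp add: complex_vector.subspace_single_0)

lemma csubspace_Times: "csubspace S \<Longrightarrow> csubspace T \<Longrightarrow> csubspace (S \<times> T)"
  by (auto simp: complex_vector.subspace_def zero_prod_def scaleC_prod_def)

section \<open>Functionals and finite-dimensional enlargements of closed subspaces\<close>

text \<open>A complex-linear functional is determined by its real part \<open>u\<close> through
\<open>\<phi> x = u x - i * u (i x)\<close>, so it is enough to extend the real part. The factor \<open>2\<close> in the bound is not
optimal but keeps the norm estimate trivial.\<close>

lemma complex_hahn_banach:
  fixes G :: "('a::complex_normed_vector \<times> complex) set"
  assumes G: "csubspace G" and dom: "\<And>x t. (x, t) \<in> G \<Longrightarrow> cmod t \<le> k * norm x" and k: "0 \<le> k"
  obtains \<phi> where "bounded_clinear \<phi>" "\<And>x t. (x, t) \<in> G \<Longrightarrow> \<phi> x = t"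
    "\<And>x. cmod (\<phi> x) \<le> 2 * k * norm x"
proof -
  define R where "R = (\<lambda>(x, t). (x, Re t)) ` G"
  have "linear (\<lambda>(x :: 'a, t). (x, Re t))"
    by (rule linearI) (auto simp: scaleR_prod_def)
  then have "subspace R"
    unfolding R_def by (intro linear_subspace_image csubspace_imp_subspace G)
  moreover have "t \<le> k * norm x" if xt: "(x, t) \<in> R" for x t
  proof -
    obtain s where s: "(x, s) \<in> G" "t = Re s"
      using xt by (auto simp: R_def)
    then show ?thesis
      using dom[OF s(1)] complex_Re_le_cmod[of s] by linarith
  qed
  ultimately obtain u where u: "linear u" "\<And>x t. (x, t) \<in> R \<Longrightarrow> u x = t"
    "\<And>x. \<bar>u x\<bar> \<le> k * norm x"
    using real_hahn_banach[of R k] k by blast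
  define \<phi> where "\<phi> x = Complex (u x) (- u (\<i> *\<^sub>C x))" for x
  have bound: "cmod (\<phi> x) \<le> 2 * k * norm x" for x
  proof -
    have "cmod (\<phi> x) \<le> \<bar>u x\<bar> + \<bar>u (\<i> *\<^sub>C x)\<bar>"
      using cmod_le[of "\<phi> x"] by (simp add: \<phi>_def)
    also have "\<dots> \<le> k * norm x + k * norm (\<i> *\<^sub>C x)"
      by (intro add_mono u(3))
    finally show ?thesis
      by (simp add: norm_scaleC)
  qed
  have add: "\<phi> (x + y) = \<phi> x + \<phi> y" for x y
    by (simp add: \<phi>_def scaleC_add_right linear_add[OF u(1)] complex_eq_iff)
  have real: "u (complex_of_real r *\<^sub>C x) = r * u x" for r x
    using linear_scale[OF u(1), of r x] by (simp add: scaleR_scaleC)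
  have scale: "\<phi> (c *\<^sub>C x) = c *\<^sub>C \<phi> x" for c x
  proof -
    have c: "c *\<^sub>C x = complex_of_real (Re c) *\<^sub>C x + complex_of_real (Im c) *\<^sub>C \<i> *\<^sub>C x"
      by (simp add: scaleC_scaleC scaleC_add_left[symmetric] complex_eq[of c, symmetric] mult.commute)
    have ic: "\<i> *\<^sub>C c *\<^sub>C x =
        complex_of_real (Re c) *\<^sub>C \<i> *\<^sub>C x + complex_of_real (- Im c) *\<^sub>C x"
      by (simp add: scaleC_scaleC scaleC_add_left[symmetric] complex_eq_iff
          del: complex_vector.scale_minus_left)
    have "u (c *\<^sub>C x) = Re c * u x + Im c * u (\<i> *\<^sub>C x)"
      unfolding c linear_add[OF u(1)] real ..
    moreover have "u (\<i> *\<^sub>C c *\<^sub>C x) = Re c * u (\<i> *\<^sub>C x) - Im c * u x"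
      unfolding ic linear_add[OF u(1)] real by simp
    ultimately show ?thesis
      by (simp add: \<phi>_def scaleC_complex_def complex_eq_iff)
  qed
  have "bounded_clinear \<phi>"
    unfolding bounded_clinear_def
  proof (intro conjI allI bounded_linear_intro[where K = "2 * k"])
    show "norm (\<phi> x) \<le> norm x * (2 * k)" for x
      using bound[of x] by (simp add: mult.commute)
  qed (simp_all add: add scale scaleR_scaleC)
  moreover have "\<phi> x = t" if "(x, t) \<in> G" for x t
  proof -
    have "(\<i> *\<^sub>C x, \<i> * t) \<in> G"
      using complex_vector.subspace_scale[OF G that, of \<i>] by (simp add: scaleC_prod_def scaleC_complex_def)
    then have "(x, Re t) \<in> R" "(\<i> *\<^sub>C x, Re (\<i> * t)) \<in> R"
      using that by (force simp: R_def)+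
    then show ?thesis
      using u(2) by (fastforce simp: \<phi>_def complex_eq_iff)
  qed
  ultimately show thesis
    using that bound by blast
qed

text \<open>On the span of \<open>S\<close> and \<open>v\<close> the coefficient of \<open>v\<close> is a functional whose norm is at most the reciprocal of
the distance \<open>d\<close> from \<open>v\<close> to \<open>S\<close>.\<close>

lemma separating_functional:
  fixes S :: "'a::complex_normed_vector set"
  assumes S: "csubspace S" "closed S" and v: "v \<notin> S"
  obtains \<phi> where "bounded_clinear \<phi>" "\<And>x. x \<in> S \<Longrightarrow> \<phi> x = (0::complex)" "\<phi> v = 1"
proof -
  obtain d where "d > 0" "ball v d \<subseteq> - S"
    using S(2) v open_contains_ball[of "- S"] by (auto simp: closed_def)
  then have d: "d > 0" "\<And>x. x \<in> S \<Longrightarrow> d \<le> norm (v - x)"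
    by (auto simp: dist_norm subset_iff not_less[symmetric])
  define G where "G = (\<lambda>(x, c). (x + c *\<^sub>C v, c)) ` (S \<times> UNIV)"
  have "bounded_clinear (\<lambda>z :: 'a \<times> complex. (fst z + snd z *\<^sub>C v, snd z))"
    by (intro bounded_clinear_intros bounded_clinear_scaleC_vector)
  then have G: "csubspace G"
    unfolding G_def case_prod_unfold
    by (rule csubspace_image) (intro csubspace_Times S complex_vector.subspace_UNIV)
  have "cmod t \<le> (1 / d) * norm x" if xt: "(x, t) \<in> G" for x t
  proof (cases "t = 0")
    case False
    obtain s where s: "s \<in> S" "x = s + t *\<^sub>C v"
      using xt by (auto simp: G_def)
    have "d \<le> norm (v - (- (1 / t)) *\<^sub>C s)"
      by (intro d complex_vector.subspace_scale S s)
    also have "v - (- (1 / t)) *\<^sub>C s = (1 / t) *\<^sub>C x"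
      using False by (simp add: s scaleC_add_right scaleC_scaleC complex_vector.scale_minus_left)
    finally show ?thesis
      using False d(1) by (simp add: norm_scaleC norm_divide field_simps)
  qed (use d in simp)
  then obtain \<phi> where \<phi>: "bounded_clinear \<phi>" "\<And>x t. (x, t) \<in> G \<Longrightarrow> \<phi> x = t"
    using complex_hahn_banach[OF G, of "1 / d"] d(1) by (metis less_eq_real_def zero_le_divide_1_iff)
  show thesis
  proof
    show "bounded_clinear \<phi>" by fact
    show "\<phi> x = 0" if "x \<in> S" for x
      by (rule \<phi>(2)) (use that in \<open>force simp: G_def\<close>)
    show "\<phi> v = 1"
      by (rule \<phi>(2)) (use complex_vector.subspace_0[OF S(1)] in \<open>force simp: G_def\<close>)
  qed
qed

text \<open>The map \<open>P\<close> takes the component along a finite-dimensional complement of \<open>S\<close> in \<open>S + span W\<close>. The last property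
exhibits \<open>S + span W\<close> as a preimage of \<open>S\<close> under a continuous map; this gives the closedness of the sum, which the
induction itself needs in order to separate the next vector. The cases \<open>S = 0\<close> and \<open>S + span W\<close> the whole
space provide projections onto finite-dimensional subspaces and along subspaces of finite codimension.\<close>

lemma csubspace_plus_span_projection:
  fixes S :: "'a::complex_normed_vector set"
  assumes S: "csubspace S" "closed S" and "finite W"
  shows "\<exists>P. bounded_clinear P \<and> range P \<subseteq> cspan W \<and> (\<forall>x\<in>S. P x = 0) \<and>
    (\<forall>x. x - P x \<in> S \<longleftrightarrow> (\<exists>w\<in>cspan W. x - w \<in> S))"
  using \<open>finite W\<close>
proof induction
  case empty
  show ?case
    by (intro exI[of _ "\<lambda>x. 0"]) (simp add: bounded_clinear_zero)
next
  case (insert v W)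
  then obtain P where P: "bounded_clinear P" "range P \<subseteq> cspan W" "\<And>x. x \<in> S \<Longrightarrow> P x = 0"
    "\<And>x. x - P x \<in> S \<longleftrightarrow> (\<exists>w\<in>cspan W. x - w \<in> S)"
    by auto
  note P_linear = bounded_clinearD[OF P(1)]
  have mono: "cspan W \<subseteq> cspan (insert v W)"
    by (rule complex_vector.span_mono) blast
  define S' where "S' = {x. x - P x \<in> S}"
  have bl: "bounded_clinear (\<lambda>x. x - P x)"
    by (intro bounded_clinear_intros P)
  have S': "csubspace S'" "closed S'"
    unfolding S'_def using S bl by (auto intro: csubspace_preimage closed_bounded_clinear_vimage)
  have "S \<subseteq> S'"
    using P(3) by (auto simp: S'_def)
  have "cspan W \<subseteq> S'"
    using P(4) complex_vector.subspace_0[OF S(1)] by (force simp: S'_def)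
  show ?case
  proof (cases "v \<in> S'")
    case True
    have "cspan (insert v W) \<subseteq> S'"
      using True \<open>cspan W \<subseteq> S'\<close> complex_vector.span_superset[of W]
      by (intro complex_vector.span_minimal S') auto
    have "x - P x \<in> S" if "w \<in> cspan (insert v W)" "x - w \<in> S" for x w
    proof -
      have "(x - w) + w \<in> S'"
        using that \<open>S \<subseteq> S'\<close> \<open>cspan (insert v W) \<subseteq> S'\<close>
        by (intro complex_vector.subspace_add[OF S'(1)]) auto
      then show ?thesis
        by (simp add: S'_def)
    qed
    then show ?thesis
      using P mono by (intro exI[of _ P]) blast
  next
    case False
    obtain \<phi> :: "'a \<Rightarrow> complex" where \<phi>: "bounded_clinear \<phi>" "\<And>x. x \<in> S' \<Longrightarrow> \<phi> x = 0" "\<phi> v = 1"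
      using separating_functional[OF S' False] by metis
    \<comment> \<open>The correction term is chosen so that \<open>v\<close> becomes a fixed point while nothing changes on \<open>S'\<close>.\<close>
    define Q where "Q x = P x + \<phi> x *\<^sub>C (v - P v)" for x
    have Q: "bounded_clinear Q"
      unfolding Q_def by (intro bounded_clinear_intros bounded_clinear_scaleC_vector P \<phi>)
    have v: "v \<in> cspan (insert v W)"
      by (simp add: complex_vector.span_base)
    have ran: "range Q \<subseteq> cspan (insert v W)"
      using P(2) mono v unfolding Q_def
      by (auto intro!: complex_vector.span_add complex_vector.span_scale complex_vector.span_diff)
    have QS: "Q x = P x" if "x \<in> S'" for x
      using that by (simp add: Q_def \<phi> complex_vector.scale_zero_left)
    have Qv: "Q v = v"
      by (simp add: Q_def \<phi>)
    have "x - Q x \<in> S" if w: "w \<in> cspan (insert v W)" "x - w \<in> S" for x w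
    proof -
      obtain c where c: "w - c *\<^sub>C v \<in> cspan W"
        using w(1) by (auto simp: complex_vector.span_breakdown_eq)
      define y where "y = x - c *\<^sub>C v"
      have "(x - w) + (w - c *\<^sub>C v) \<in> S'"
        using c w(2) \<open>S \<subseteq> S'\<close> \<open>cspan W \<subseteq> S'\<close>
        by (intro complex_vector.subspace_add[OF S'(1)]) auto
      then have y: "y \<in> S'"
        by (simp add: y_def)
      have "x = y + c *\<^sub>C v"
        by (simp add: y_def)
      then have "x - Q x = y - P y"
        using QS[OF y] by (simp add: bounded_clinearD[OF Q] Qv)
      then show ?thesis
        using y by (simp add: S'_def)
    qed
    then show ?thesis
      using Q ran QS \<open>S \<subseteq> S'\<close> P(3) by (intro exI[of _ Q]) (metis rangeI subsetD)
  qed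
qed

lemma closed_plus_span:
  fixes S :: "'a::complex_normed_vector set"
  assumes S: "csubspace S" "closed S" and "finite W"
  shows "closed {x. \<exists>w\<in>cspan W. x - w \<in> S}"
proof -
  obtain P where P: "bounded_clinear P" "\<And>x. x - P x \<in> S \<longleftrightarrow> (\<exists>w\<in>cspan W. x - w \<in> S)"
    using csubspace_plus_span_projection[OF assms] by blast
  have "closed {x. x - P x \<in> S}"
    by (intro closed_bounded_clinear_vimage bounded_clinear_intros P S)
  then show ?thesis
    by (simp add: P)
qed

lemma span_projection:
  fixes W :: "'a::complex_normed_vector set"
  assumes "finite W"
  obtains P where "bounded_clinear P" "range P \<subseteq> cspan W" "\<And>x. x \<in> cspan W \<Longrightarrow> P x = x"
proof -
  obtain P :: "'a \<Rightarrow> 'a" where P: "bounded_clinear P" "range P \<subseteq> cspan W"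
    "\<And>x. x - P x \<in> {0} \<longleftrightarrow> (\<exists>w\<in>cspan W. x - w \<in> {0})"
    using csubspace_plus_span_projection[OF complex_vector.subspace_single_0 closed_singleton assms]
    by blast
  then show thesis
    using that[of P] by force
qed

section \<open>Finite-dimensional subspaces and maps of finite rank\<close>

definition finite_dim :: "'a::complex_normed_vector set \<Rightarrow> bool"
  where "finite_dim S \<longleftrightarrow> (\<exists>W. finite W \<and> S \<subseteq> cspan W)"

lemma finite_dimI: "finite W \<Longrightarrow> S \<subseteq> cspan W \<Longrightarrow> finite_dim S"
  by (auto simp: finite_dim_def)

lemma finite_dim_subset: "finite_dim T \<Longrightarrow> S \<subseteq> T \<Longrightarrow> finite_dim S"
  by (auto simp: finite_dim_def)

lemma finite_dim_sum:
  assumes "finite_dim S" "finite_dim T"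
  shows "finite_dim {x. \<exists>t\<in>T. x - t \<in> S}"
proof -
  obtain W V where W: "finite W" "S \<subseteq> cspan W" and V: "finite V" "T \<subseteq> cspan V"
    using assms by (auto simp: finite_dim_def)
  have mono: "cspan W \<subseteq> cspan (W \<union> V)" "cspan V \<subseteq> cspan (W \<union> V)"
    by (intro complex_vector.span_mono; blast)+
  have "(x - t) + t \<in> cspan (W \<union> V)" if "t \<in> T" "x - t \<in> S" for x t
    using that W(2) V(2) mono by (intro complex_vector.span_add) auto
  then show ?thesis
    using W(1) V(1) by (intro finite_dimI[of "W \<union> V"]) auto
qed

lemma finite_dim_image:
  assumes "bounded_clinear f" "finite_dim S"
  shows "finite_dim (f ` S)"
proof -
  obtain W where "finite W" "S \<subseteq> cspan W"
    using assms(2) by (auto simp: finite_dim_def)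
  then show ?thesis
    using bounded_clinear_span_image[OF assms(1), of W] by (intro finite_dimI[of "f ` W"]) auto
qed

lemma finite_dim_basis:
  assumes "finite_dim S"
  obtains B where "finite B" "B \<subseteq> S" "\<not> complex_vector.dependent B" "S \<subseteq> cspan B"
proof -
  obtain W where W: "finite W" "S \<subseteq> cspan W"
    using assms by (auto simp: finite_dim_def)
  obtain B where B: "B \<subseteq> S" "\<not> complex_vector.dependent B" "S \<subseteq> cspan B"
    using complex_vector.maximal_independent_subset[of S] unfolding cspan_def by metis
  then have "finite B"
    using complex_vector.independent_span_bound[OF W(1) B(2)] W(2) by blast
  then show thesis
    using that B by blast
qed

lemma finite_dim_csubspace_eq_span:
  assumes "finite_dim S" "csubspace S"
  obtains B where "finite B" "cspan B = S"
proof -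
  obtain B where B: "finite B" "B \<subseteq> S" "S \<subseteq> cspan B"
    using finite_dim_basis[OF assms(1)] by metis
  then have "cspan B = S"
    using complex_vector.span_minimal[OF B(2) assms(2)] by blast
  then show thesis
    using that B by blast
qed

text \<open>Preimages of a basis of the image span a subspace with the same image. The vectors are kept inside \<open>S\<close> so
that differences stay in \<open>S\<close> when \<open>S\<close> is a subspace.\<close>

lemma finite_dim_image_lift:
  assumes f: "bounded_clinear f" and fin: "finite_dim (f ` S)"
  obtains U where "finite U" "U \<subseteq> S" "\<And>x. x \<in> S \<Longrightarrow> \<exists>u\<in>cspan U. f x = f u"
proof -
  obtain B where B: "finite B" "B \<subseteq> f ` S" "f ` S \<subseteq> cspan B"
    using finite_dim_basis[OF fin] by metis
  then obtain U where U: "U \<subseteq> S" "finite U" "B = f ` U"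
    using finite_subset_image[of B f S] by blast
  have "\<exists>u\<in>cspan U. f x = f u" if "x \<in> S" for x
    using B(3) that bounded_clinear_span_image[OF f, of U] unfolding U(3) by auto
  then show thesis
    using that U by blast
qed

lemma finite_dim_kernel_image:
  assumes f: "bounded_clinear f" and S: "csubspace S" and fin: "finite_dim (f ` S)"
    and ker: "finite_dim {x \<in> S. f x = 0}"
  shows "finite_dim S"
proof -
  obtain U where U: "finite U" "U \<subseteq> S" "\<And>x. x \<in> S \<Longrightarrow> \<exists>u\<in>cspan U. f x = f u"
    using finite_dim_image_lift[OF f fin] by blast
  have "cspan U \<subseteq> S"
    by (rule complex_vector.span_minimal[OF U(2) S])
  then have "S \<subseteq> {x. \<exists>u\<in>cspan U. x - u \<in> {x \<in> S. f x = 0}}"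
    using U(3) by (fastforce simp: bounded_clinearD[OF f] intro: complex_vector.subspace_diff[OF S])
  moreover have "finite_dim (cspan U)"
    using U(1) by (auto simp: finite_dim_def)
  ultimately show ?thesis
    using finite_dim_sum[OF ker] finite_dim_subset by blast
qed

text \<open>At an index where the size of a basis is minimal, a strict inclusion further on would yield too large an
independent set.\<close>

lemma decreasing_finite_dim_stabilizes:
  assumes sub: "\<And>n. csubspace (D n)" and dec: "\<And>n. D (Suc n) \<subseteq> D n" and fin: "finite_dim (D 0)"
  obtains m where "\<And>n. n \<ge> m \<Longrightarrow> D n = D m"
proof -
  have le: "D n \<subseteq> D m" if "m \<le> n" for m n
    using that by (induction rule: dec_induct) (use dec in blast)+
  have "finite_dim (D n)" for n
    using finite_dim_subset[OF fin le[of 0 n]] by simp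
  then have "\<exists>B. finite B \<and> B \<subseteq> D n \<and> \<not> complex_vector.dependent B \<and> D n \<subseteq> cspan B" for n
    using finite_dim_basis by metis
  then obtain B where B: "\<And>n. finite (B n)" "\<And>n. B n \<subseteq> D n"
    "\<And>n. \<not> complex_vector.dependent (B n)" "\<And>n. D n \<subseteq> cspan (B n)"
    by metis
  define m where "m = (ARG_MIN (\<lambda>n. card (B n)) n. True)"
  have min: "card (B m) \<le> card (B n)" for n
    unfolding m_def by (rule arg_min_nat_le) simp
  have "D m \<subseteq> D n" if n: "m \<le> n" for n
  proof (rule ccontr)
    assume "\<not> D m \<subseteq> D n"
    then obtain x where x: "x \<in> D m" "x \<notin> D n"
      by blast
    have "cspan (B n) \<subseteq> D n"
      by (rule complex_vector.span_minimal[OF B(2) sub])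
    then have "x \<notin> cspan (B n)"
      using x by blast
    then have "\<not> complex_vector.dependent (insert x (B n))" "x \<notin> B n"
      using B(3) complex_vector.span_superset[of "B n"]
      by (auto simp: complex_vector.independent_insert cspan_def)
    moreover have "insert x (B n) \<subseteq> cspan (B m)"
      using x(1) B(2)[of n] B(4)[of m] le[OF n] by blast
    ultimately have "Suc (card (B n)) \<le> card (B m)"
      using complex_vector.independent_span_bound[OF B(1)[of m]] B(1)[of n] by fastforce
    then show False
      using min[of n] by simp
  qed
  then show thesis
    using that[of m] le by blast
qed

definition finite_rank :: "('a \<Rightarrow> 'b::complex_normed_vector) \<Rightarrow> bool"
  where "finite_rank f \<longleftrightarrow> finite_dim (range f)"

lemma finite_rank_precompose: "finite_rank f \<Longrightarrow> finite_rank (\<lambda>x. f (g x))"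
  unfolding finite_rank_def by (erule finite_dim_subset) blast

lemma finite_rank_postcompose:
  "bounded_clinear g \<Longrightarrow> finite_rank f \<Longrightarrow> finite_rank (\<lambda>x. g (f x))"
  unfolding finite_rank_def using finite_dim_image[of g "range f"] by (simp add: image_image)

lemma finite_rank_add:
  assumes "finite_rank f" "finite_rank g"
  shows "finite_rank (\<lambda>x. f x + g x)"
  unfolding finite_rank_def
proof (rule finite_dim_subset[OF finite_dim_sum[OF assms[unfolded finite_rank_def]]], clarify)
  show "\<exists>t\<in>range g. f x + g x - t \<in> range f" for x
    by (rule bexI[of _ "g x"]) auto
qed

lemma finite_rank_minus: "finite_rank f \<Longrightarrow> finite_rank (\<lambda>x. - f x)"
  using finite_rank_postcompose[of uminus f] bounded_clinear_minus[OF bounded_clinear_ident] by simp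

lemma finite_rank_diff: "finite_rank f \<Longrightarrow> finite_rank g \<Longrightarrow> finite_rank (\<lambda>x. f x - g x)"
  using finite_rank_add[OF _ finite_rank_minus, of f g] by simp

lemma finite_rank_Pair:
  assumes "finite_rank f" "finite_rank g"
  shows "finite_rank (\<lambda>x. (f x, g x))"
proof -
  have "finite_rank (\<lambda>x. (f x, 0) + (0, g x))"
    by (intro finite_rank_add finite_rank_postcompose[of "\<lambda>y. (y, 0)"]
        finite_rank_postcompose[of "\<lambda>y. (0, y)"] bounded_clinear_intros assms)
  then show ?thesis
    by simp
qed

section \<open>Semi-Fredholm operators through estimates and regularizers\<close>

lemma csubspace_op_ker: "csubspace (op_ker T)"
  unfolding op_ker_def by (rule csubspace_kernel[OF bounded_clinear_cblinfun_apply])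

lemma csubspace_op_range: "csubspace (op_range T)"
  unfolding op_range_def
  by (rule csubspace_image[OF bounded_clinear_cblinfun_apply complex_vector.subspace_UNIV])

lemma nullity_finite_iff: "nullity T < \<infinity> \<longleftrightarrow> finite_dim (op_ker T)"
  by (simp add: nullity_def ecdim_def finite_dim_def)

lemma \<Phi>_plus_iff: "T \<in> \<Phi>_plus \<longleftrightarrow> finite_dim (op_ker T) \<and> closed (op_range T)"
  unfolding \<Phi>_plus_def nullity_finite_iff by simp

lemma \<Phi>_l_iff:
  "T \<in> \<Phi>_l \<longleftrightarrow> finite_dim (op_ker T) \<and> closed (op_range T) \<and> complemented (op_range T)"
  unfolding \<Phi>_l_def nullity_finite_iff by auto

text \<open>Modulo a projection \<open>P\<close> onto a finite-dimensional space containing the kernel, the open mapping theorem for the closed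
range bounds a vector by its image.\<close>

lemma \<Phi>_plus_estimate:
  fixes T :: "'a::cbanach \<Rightarrow>\<^sub>C\<^sub>L 'a"
  assumes "T \<in> \<Phi>_plus"
  obtains P K where "bounded_clinear P" "finite_rank P" "0 \<le> K"
    "\<And>x. norm x \<le> K * norm (T *\<^sub>V x) + norm (P x :: 'a)"
proof -
  have "finite_dim (op_ker T)" and cl: "closed (range (cblinfun_apply T))"
    using assms by (simp_all add: \<Phi>_plus_iff op_range_def)
  then obtain W where W: "finite W" "op_ker T \<subseteq> cspan W"
    by (auto simp: finite_dim_def)
  obtain P where P: "bounded_clinear P" "range P \<subseteq> cspan W" "\<And>x. x \<in> cspan W \<Longrightarrow> P x = x"
    using span_projection[OF W(1)] by blast
  obtain p where p: "0 \<le> p" "\<And>x. norm (P x) \<le> p * norm x"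
    using bounded_clinear_bound[OF P(1)] by blast
  obtain K where K: "0 \<le> K" "\<And>z. z \<in> range (cblinfun_apply T) \<Longrightarrow>
      \<exists>x\<in>UNIV. T *\<^sub>V x = z \<and> norm x \<le> K * norm z"
    using open_mapping_closed_range[OF bounded_linear_cblinfun_apply subspace_UNIV closed_UNIV cl] by metis
  show thesis
  proof
    show "bounded_clinear P" by fact
    show "finite_rank P"
      using P(2) W(1) by (auto simp: finite_rank_def finite_dim_def)
    show "0 \<le> (1 + p) * K"
      using p K by simp
    fix x
    obtain y where y: "T *\<^sub>V y = T *\<^sub>V x" "norm y \<le> K * norm (T *\<^sub>V x)"
      using K(2)[OF rangeI, of x] by auto
    have "x - y \<in> op_ker T"
      by (simp add: op_ker_def cblinfun_linear y)
    then have "P (x - y) = x - y"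
      using W(2) P(3) by blast
    \<comment> \<open>The preimage \<open>y\<close> of \<open>T x\<close> is small, and \<open>x - y\<close> lies in the kernel, where \<open>P\<close> is the identity.\<close>
    then have "x = (y - P y) + P x"
      by (simp add: bounded_clinearD[OF P(1)] algebra_simps)
    then have "norm x \<le> norm (y - P y) + norm (P x)"
      by (metis norm_triangle_ineq)
    also have "norm (y - P y) \<le> norm y + p * norm y"
      using norm_triangle_ineq4[of y "P y"] p(2)[of y] by linarith
    also have "\<dots> = (1 + p) * norm y"
      by (simp add: algebra_simps)
    also have "\<dots> \<le> (1 + p) * (K * norm (T *\<^sub>V x))"
      using y(2) p(1) by (intro mult_left_mono) auto
    finally show "norm x \<le> (1 + p) * K * norm (T *\<^sub>V x) + norm (P x)"
      by (simp add: mult.assoc)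
  qed
qed

text \<open>On the kernel of \<open>F\<close> the operator is bounded below, so it has closed image there; the full range is a
finite-dimensional enlargement of that image. Allowing an arbitrary target for \<open>F\<close> lets several
finite-rank terms be combined into one by pairing.\<close>

lemma \<Phi>_plus_of_estimate:
  fixes T :: "'a::cbanach \<Rightarrow>\<^sub>C\<^sub>L 'a" and F :: "'a \<Rightarrow> 'c::complex_normed_vector"
  assumes F: "bounded_clinear F" "finite_rank F"
    and est: "\<And>x. norm x \<le> K * norm (T *\<^sub>V x) + L * norm (F x)"
  shows "T \<in> \<Phi>_plus"
proof -
  have "finite_dim (op_ker T)"
  proof (rule finite_dim_kernel_image[OF F(1) csubspace_op_ker])
    show "finite_dim (F ` op_ker T)"
      using F(2) unfolding finite_rank_def by (rule finite_dim_subset) blast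
    have "{x \<in> op_ker T. F x = 0} \<subseteq> cspan {}"
    proof
      fix x assume "x \<in> {x \<in> op_ker T. F x = 0}"
      then show "x \<in> cspan {}"
        using est[of x] by (simp add: op_ker_def)
    qed
    then show "finite_dim {x \<in> op_ker T. F x = 0}"
      by (rule finite_dimI[rotated]) simp
  qed
  moreover have "closed (op_range T)"
  proof -
    define N where "N = {x. F x = 0}"
    have N: "csubspace N" "closed N"
      unfolding N_def using csubspace_kernel[OF F(1)] closed_bounded_clinear_vimage[OF F(1), of "{0}"]
      by simp_all
    obtain U where U: "finite U" "\<And>x. x \<in> UNIV \<Longrightarrow> \<exists>u\<in>cspan U. F x = F u"
      using finite_dim_image_lift[OF F(1) F(2)[unfolded finite_rank_def]] by metis
    define k where "k = max K 1"
    have "k > 0"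
      by (simp add: k_def)
    have "complete (cblinfun_apply T ` N)"
    proof (rule complete_isometric_image[of "1 / k"])
      show "\<forall>x\<in>N. 1 / k * norm x \<le> norm (T *\<^sub>V x)"
      proof
        fix x assume "x \<in> N"
        then have "norm x \<le> K * norm (T *\<^sub>V x)"
          using est[of x] by (simp add: N_def)
        also have "\<dots> \<le> k * norm (T *\<^sub>V x)"
          by (intro mult_right_mono) (simp_all add: k_def)
        finally show "1 / k * norm x \<le> norm (T *\<^sub>V x)"
          using \<open>k > 0\<close> by (simp add: field_simps)
      qed
    qed (use \<open>k > 0\<close> N in \<open>auto simp: complete_eq_closed bounded_linear_cblinfun_apply
        intro: csubspace_imp_subspace\<close>)
    then have TN: "csubspace (cblinfun_apply T ` N)" "closed (cblinfun_apply T ` N)"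
      using csubspace_image[OF bounded_clinear_cblinfun_apply N(1)] by (auto simp: complete_eq_closed)
    have "op_range T = {z. \<exists>w\<in>cspan (cblinfun_apply T ` U). z - w \<in> cblinfun_apply T ` N}"
    proof (intro equalityI subsetI)
      fix z assume "z \<in> op_range T"
      then obtain x where x: "z = T *\<^sub>V x"
        by (auto simp: op_range_def)
      obtain u where u: "u \<in> cspan U" "F x = F u"
        using U(2)[OF UNIV_I] by metis
      then have "z - T *\<^sub>V u = T *\<^sub>V (x - u)" "x - u \<in> N"
        by (simp_all add: x N_def cblinfun_linear bounded_clinearD[OF F(1)])
      then show "z \<in> {z. \<exists>w\<in>cspan (cblinfun_apply T ` U). z - w \<in> cblinfun_apply T ` N}"
        using u(1) by (auto simp: bounded_clinear_span_image[OF bounded_clinear_cblinfun_apply])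
    next
      fix z assume "z \<in> {z. \<exists>w\<in>cspan (cblinfun_apply T ` U). z - w \<in> cblinfun_apply T ` N}"
      then obtain u x where "z - T *\<^sub>V u = T *\<^sub>V x"
        by (auto simp: bounded_clinear_span_image[OF bounded_clinear_cblinfun_apply])
      then have "z = T *\<^sub>V (x + u)"
        by (simp add: cblinfun_linear algebra_simps)
      then show "z \<in> op_range T"
        by (simp add: op_range_def)
    qed
    then show ?thesis
      using closed_plus_span[OF TN] U(1) by simp
  qed
  ultimately show ?thesis
    by (simp add: \<Phi>_plus_iff)
qed

lemma bounded_inverse_on_subspace:
  fixes f :: "'a::cbanach \<Rightarrow> 'b::cbanach"
  assumes f: "bounded_clinear f" and V: "csubspace V" "closed V" and surj: "f ` V = UNIV"
    and inj: "\<And>v. v \<in> V \<Longrightarrow> f v = 0 \<Longrightarrow> v = 0"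
  obtains g where "bounded_clinear g" "\<And>z. g z \<in> V" "\<And>z. f (g z) = z"
proof -
  have bl: "bounded_linear f" and cl: "closed (f ` V)"
    using f by (simp_all add: bounded_clinear_def surj)
  obtain K where "\<And>z. z \<in> f ` V \<Longrightarrow> \<exists>x\<in>V. f x = z \<and> norm x \<le> K * norm z"
    using open_mapping_closed_range[OF bl csubspace_imp_subspace[OF V(1)] V(2) cl] by metis
  then have "\<exists>x\<in>V. f x = z \<and> norm x \<le> K * norm z" for z
    using surj by blast
  then obtain g where g: "\<And>z. g z \<in> V" "\<And>z. f (g z) = z" "\<And>z. norm (g z) \<le> K * norm z"
    by metis
  have uniq: "v = g z" if "v \<in> V" "f v = z" for v z
    using inj[of "v - g z"] complex_vector.subspace_diff[OF V(1) that(1) g(1)[of z]] that(2)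
    by (simp add: bounded_clinearD[OF f] g)
  have add: "g (x + y) = g x + g y" for x y
    using complex_vector.subspace_add[OF V(1) g(1) g(1)]
    by (intro uniq[symmetric]) (simp_all add: bounded_clinearD[OF f] g)
  have scale: "g (c *\<^sub>C x) = c *\<^sub>C g x" for c x
    using complex_vector.subspace_scale[OF V(1) g(1)]
    by (intro uniq[symmetric]) (simp_all add: bounded_clinearD[OF f] g)
  have "bounded_clinear g"
    unfolding bounded_clinear_def
  proof (intro conjI allI bounded_linear_intro[where K = K])
    show "norm (g x) \<le> norm x * K" for x
      using g(3)[of x] by (simp add: mult.commute)
  qed (simp_all add: add scale scaleR_scaleC)
  then show thesis
    using that g by blast
qed

text \<open>With complements \<open>V1\<close> of the kernel and \<open>N\<close> of the range, \<open>(x, n) \<mapsto> T x + n\<close> is a bijection from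
\<open>V1 \<times> N\<close> onto the space; the first component of its bounded inverse is an inverse of \<open>T\<close> modulo the kernel.\<close>

lemma \<Phi>_l_regularizer:
  fixes T :: "'a::cbanach \<Rightarrow>\<^sub>C\<^sub>L 'a"
  assumes "T \<in> \<Phi>_l"
  obtains S where "bounded_clinear S" "finite_rank (\<lambda>x. S (T *\<^sub>V x) - x)"
    "\<And>x. T *\<^sub>V S (T *\<^sub>V x) = T *\<^sub>V x"
proof -
  have "finite_dim (op_ker T)" and "complemented (op_range T)"
    using assms by (simp_all add: \<Phi>_l_iff)
  then obtain N where N: "csubspace N" "closed N" "op_range T \<inter> N = {0}"
    "{m + n | m n. m \<in> op_range T \<and> n \<in> N} = UNIV"
    by (auto simp: complemented_def)
  obtain W where W: "finite W" "cspan W = op_ker T"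
    using finite_dim_csubspace_eq_span[OF \<open>finite_dim (op_ker T)\<close> csubspace_op_ker] by blast
  obtain P where P: "bounded_clinear P" "range P \<subseteq> cspan W" "\<And>x. x \<in> cspan W \<Longrightarrow> P x = x"
    using span_projection[OF W(1)] by blast
  define V where "V = {x. P x = 0} \<times> N"
  define \<Theta> where "\<Theta> = (\<lambda>v. T *\<^sub>V fst v + snd v)"
  have \<Theta>: "bounded_clinear \<Theta>"
    unfolding \<Theta>_def by (intro bounded_clinear_intros)
  have V: "csubspace V" "closed V"
    unfolding V_def using N csubspace_kernel[OF P(1)] closed_bounded_clinear_vimage[OF P(1), of "{0}"]
    by (simp_all add: csubspace_Times closed_Times)
  have surj: "\<Theta> ` V = UNIV"
  proof -
    have "z \<in> \<Theta> ` V" for z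
    proof -
      obtain x n where n: "n \<in> N" "z = T *\<^sub>V x + n"
        using N(4) unfolding op_range_def by blast
      have "P x \<in> cspan W"
        using P(2) by blast
      then have "T *\<^sub>V P x = 0" "P (P x) = P x"
        using W(2) P(3) by (auto simp: op_ker_def)
      then have "(x - P x, n) \<in> V" "z = \<Theta> (x - P x, n)"
        using n by (simp_all add: V_def \<Theta>_def cblinfun_linear bounded_clinearD[OF P(1)])
      then show ?thesis
        by blast
    qed
    then show ?thesis
      by blast
  qed
  have zero: "T *\<^sub>V x = 0 \<and> n = 0" if "n \<in> N" "T *\<^sub>V x + n = 0" for x n
  proof -
    have "n = T *\<^sub>V (- x)"
      using that(2) by (simp add: cblinfun_linear eq_neg_iff_add_eq_0 add.commute)
    then have "n \<in> op_range T \<inter> N"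
      using that(1) by (auto simp: op_range_def)
    then show ?thesis
      using that N(3) by auto
  qed
  have inj: "v = 0" if "v \<in> V" "\<Theta> v = 0" for v
  proof -
    have "T *\<^sub>V fst v = 0 \<and> snd v = 0"
      using that by (intro zero) (auto simp: V_def \<Theta>_def)
    then show ?thesis
      using that(1) P(3)[of "fst v"] W(2) by (auto simp: V_def op_ker_def prod_eq_iff)
  qed
  obtain g where g: "bounded_clinear g" "\<And>z. g z \<in> V" "\<And>z. \<Theta> (g z) = z"
    using bounded_inverse_on_subspace[OF \<Theta> V surj inj] by blast
  have same: "T *\<^sub>V fst (g (T *\<^sub>V x)) = T *\<^sub>V x" for x
  proof -
    have "T *\<^sub>V (fst (g (T *\<^sub>V x)) - x) + snd (g (T *\<^sub>V x)) = 0"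
      using g(3)[of "T *\<^sub>V x"] by (simp add: \<Theta>_def cblinfun_linear algebra_simps)
    then have "T *\<^sub>V (fst (g (T *\<^sub>V x)) - x) = 0"
      using zero[of "snd (g (T *\<^sub>V x))"] g(2)[of "T *\<^sub>V x"] by (auto simp: V_def)
    then show ?thesis
      by (simp add: cblinfun_linear)
  qed
  show thesis
  proof
    show "bounded_clinear (\<lambda>z. fst (g z))"
      by (intro bounded_clinear_intros g)
    have "range (\<lambda>x. fst (g (T *\<^sub>V x)) - x) \<subseteq> op_ker T"
      using same by (auto simp: op_ker_def cblinfun_linear)
    then show "finite_rank (\<lambda>x. fst (g (T *\<^sub>V x)) - x)"
      unfolding finite_rank_def using \<open>finite_dim (op_ker T)\<close> finite_dim_subset by blast
  qed (rule same)
qed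

text \<open>A finite-rank map has a bounded generalized inverse: basis vectors of the range are sent to chosen
preimages one after the other, using functionals that separate each from the previous ones.\<close>

lemma finite_rank_generalized_inverse:
  fixes G :: "'a::complex_normed_vector \<Rightarrow> 'b::complex_normed_vector"
  assumes G: "bounded_clinear G" "finite_rank G"
  obtains H where "bounded_clinear H" "\<And>x. G (H (G x)) = G x"
proof -
  have ex: "\<exists>H. bounded_clinear H \<and> (\<forall>w\<in>B. G (H w) = w)" if "finite B" "B \<subseteq> range G" for B
    using that
  proof induction
    case empty
    show ?case
      by (intro exI[of _ "\<lambda>x. 0"]) (simp add: bounded_clinear_zero)
  next
    case (insert v B)
    then obtain H where H: "bounded_clinear H" "\<And>w. w \<in> B \<Longrightarrow> G (H w) = w"
      by auto
    obtain u where u: "G u = v"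
      using insert.prems by auto
    have clos: "closed (cspan B)"
      using closed_plus_span[OF complex_vector.subspace_single_0 closed_singleton \<open>finite B\<close>] by simp
    have fixed: "cspan B \<subseteq> {w. G (H w) - w \<in> {0}}"
      using H by (intro complex_vector.span_minimal csubspace_preimage bounded_clinear_diff
          bounded_clinear_compose[OF G(1)] bounded_clinear_ident complex_vector.subspace_single_0) auto
    show ?case
    proof (cases "v \<in> cspan B")
      case True
      then show ?thesis
        using H fixed by (intro exI[of _ H]) auto
    next
      case False
      obtain \<phi> :: "'b \<Rightarrow> complex" where \<phi>: "bounded_clinear \<phi>"
        "\<And>x. x \<in> cspan B \<Longrightarrow> \<phi> x = 0" "\<phi> v = 1"
        using separating_functional[OF complex_vector.subspace_span clos False] unfolding cspan_def by metis
      have "bounded_clinear (\<lambda>x. H x + \<phi> x *\<^sub>C (u - H v))"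
        by (intro bounded_clinear_intros bounded_clinear_scaleC_vector H \<phi>)
      moreover have "G (H w + \<phi> w *\<^sub>C (u - H v)) = w" if "w \<in> insert v B" for w
        using that H(2) \<phi>(2)[OF complex_vector.span_base, of w]
        by (auto simp: \<phi>(3) u bounded_clinearD[OF G(1)] complex_vector.scale_zero_left)
      ultimately show ?thesis
        by blast
    qed
  qed
  obtain B where B: "finite B" "B \<subseteq> range G" "range G \<subseteq> cspan B"
    using finite_dim_basis[OF G(2)[unfolded finite_rank_def]] by metis
  obtain H where H: "bounded_clinear H" "\<And>w. w \<in> B \<Longrightarrow> G (H w) = w"
    using ex[OF B(1,2)] by blast
  have "cspan B \<subseteq> {w. G (H w) - w \<in> {0}}"
    using H by (intro complex_vector.span_minimal csubspace_preimage bounded_clinear_diff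
        bounded_clinear_compose[OF G(1)] bounded_clinear_ident complex_vector.subspace_single_0) auto
  then show thesis
    using that[OF H(1)] B(3) by (auto simp: subset_iff)
qed

text \<open>The defect \<open>T - T S T\<close> has finite rank, hence a generalized inverse \<open>H\<close>. Then
\<open>R = S + (1 - S T) H (1 - T S)\<close> satisfies \<open>T R T = T\<close>, because \<open>T R T\<close> is \<open>T S T\<close> plus the
defect. So \<open>T R\<close> is a bounded projection onto the range of \<open>T\<close>.\<close>

lemma \<Phi>_l_of_regularizer:
  fixes T :: "'a::cbanach \<Rightarrow>\<^sub>C\<^sub>L 'a"
  assumes S: "bounded_clinear S" and fin: "finite_rank (\<lambda>x. S (T *\<^sub>V x) - x)"
  shows "T \<in> \<Phi>_l"
proof -
  define G where "G x = T *\<^sub>V x - T *\<^sub>V S (T *\<^sub>V x)" for x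
  have G: "bounded_clinear G"
    unfolding G_def by (intro bounded_clinear_intros bounded_clinear_compose[OF S])
  have "finite_rank (\<lambda>x. - (T *\<^sub>V (S (T *\<^sub>V x) - x)))"
    by (intro finite_rank_minus finite_rank_postcompose[OF bounded_clinear_cblinfun_apply] fin)
  then have "finite_rank G"
    by (simp add: G_def[abs_def] cblinfun_linear)
  then obtain H where H: "bounded_clinear H" "\<And>x. G (H (G x)) = G x"
    using finite_rank_generalized_inverse[OF G] by blast
  define R where "R z = S z + (H (z - T *\<^sub>V S z) - S (T *\<^sub>V H (z - T *\<^sub>V S z)))" for z
  have R: "bounded_clinear R"
    unfolding R_def
    by (intro bounded_clinear_intros bounded_clinear_compose[OF S] bounded_clinear_compose[OF H(1)] S)
  have TR: "T *\<^sub>V R (T *\<^sub>V x) = T *\<^sub>V x" for x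
  proof -
    have "T *\<^sub>V R (T *\<^sub>V x) = T *\<^sub>V S (T *\<^sub>V x) + G (H (G x))"
      by (simp add: R_def G_def cblinfun_linear)
    also have "\<dots> = T *\<^sub>V x"
      unfolding H(2) by (simp add: G_def)
    finally show ?thesis .
  qed
  have range: "op_range T = {z. T *\<^sub>V R z - z \<in> {0}}"
  proof -
    have "z \<in> op_range T" if "T *\<^sub>V R z = z" for z
      using that by (metis op_range_def rangeI)
    then show ?thesis
      using TR by (auto simp: op_range_def)
  qed
  have "closed (op_range T)"
    unfolding range
    by (intro closed_bounded_clinear_vimage bounded_clinear_intros R closed_singleton)
  moreover have "complemented (op_range T)"
    unfolding complemented_def
  proof (intro exI conjI)
    let ?N = "{z. T *\<^sub>V R z \<in> {0}}"
    show "csubspace ?N"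
      by (intro csubspace_preimage bounded_clinear_intros R complex_vector.subspace_single_0)
    show "closed ?N"
      by (intro closed_bounded_clinear_vimage bounded_clinear_intros R closed_singleton)
    show "op_range T \<inter> ?N = {0}"
      by (auto simp: range cblinfun_linear bounded_clinearD[OF R])
    have "z \<in> {m + n | m n. m \<in> op_range T \<and> n \<in> ?N}" for z
    proof -
      have "z = T *\<^sub>V R z + (z - T *\<^sub>V R z)" "T *\<^sub>V R z \<in> op_range T" "z - T *\<^sub>V R z \<in> ?N"
        by (simp_all add: op_range_def bounded_clinearD[OF R] cblinfun_linear TR)
      then show ?thesis
        by blast
    qed
    then show "{m + n | m n. m \<in> op_range T \<and> n \<in> ?N} = UNIV"
      by blast
  qed
  moreover have "finite_dim (op_ker T)"
  proof -
    have "op_ker T \<subseteq> range (\<lambda>x. S (T *\<^sub>V x) - x)"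
    proof
      fix x assume "x \<in> op_ker T"
      then have "x = S (T *\<^sub>V (- x)) - (- x)"
        by (simp add: op_ker_def cblinfun_linear bounded_clinearD[OF S])
      then show "x \<in> range (\<lambda>x. S (T *\<^sub>V x) - x)"
        by blast
    qed
    then show ?thesis
      using fin finite_dim_subset unfolding finite_rank_def by blast
  qed
  ultimately show ?thesis
    by (simp add: \<Phi>_l_iff)
qed

lemma \<Phi>_l_subset_\<Phi>_plus: "\<Phi>_l \<subseteq> \<Phi>_plus"
  by (auto simp: \<Phi>_l_iff \<Phi>_plus_iff)

lemma complemented_finite_codim:
  fixes S :: "'a::complex_normed_vector set"
  assumes S: "csubspace S" "closed S" and W: "finite W" "\<And>x. \<exists>w\<in>cspan W. x - w \<in> S"
  shows "complemented S"
proof -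
  obtain P where P: "bounded_clinear P" "\<And>x. x \<in> S \<Longrightarrow> P x = 0" "\<And>x. x - P x \<in> S"
    using csubspace_plus_span_projection[OF S W(1)] W(2) by blast
  have idem: "P (P x) = P x" for x
    using P(2)[OF P(3)[of x]] by (simp add: bounded_clinearD[OF P(1)])
  show ?thesis
    unfolding complemented_def
  proof (intro exI conjI)
    let ?N = "{x. P x - x \<in> {0}}"
    show "csubspace ?N"
      by (intro csubspace_preimage bounded_clinear_intros P complex_vector.subspace_single_0)
    show "closed ?N"
      by (intro closed_bounded_clinear_vimage bounded_clinear_intros P closed_singleton)
    show "S \<inter> ?N = {0}"
      using P(2) complex_vector.subspace_0[OF S(1)] by (force simp: bounded_clinearD[OF P(1)])
    have "x \<in> {m + n | m n. m \<in> S \<and> n \<in> ?N}" for x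
    proof -
      have "x = (x - P x) + P x" "P x \<in> ?N"
        by (simp_all add: idem)
      then show ?thesis
        using P(3)[of x] by blast
    qed
    then show "{m + n | m n. m \<in> S \<and> n \<in> ?N} = UNIV"
      by blast
  qed
qed

section \<open>Backward orbits and failure of the SVEP\<close>

text \<open>Termwise, the difference quotient of the series is again a series, with coefficient
\<open>q n v = (v^n - w^n) / (v - w)\<close>, a polynomial in \<open>v\<close>. It converges uniformly on the disc by the M-test, so its sum
\<open>g\<close> is continuous and the quotient tends to \<open>g w\<close>.\<close>

lemma power_series_quotient_limit:
  fixes x :: "nat \<Rightarrow> 'a::cbanach"
  assumes bound: "\<And>n. norm (x n) \<le> c * \<kappa> ^ n" and \<kappa>: "0 \<le> \<kappa>" and \<rho>: "\<rho> * \<kappa> < 1" and w: "cmod w < \<rho>"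
  defines "f \<equiv> \<lambda>z. \<Sum>n. z ^ n *\<^sub>C x n"
  shows "\<exists>D. ((\<lambda>v. inverse (v - w) *\<^sub>C (f v - f w)) \<longlongrightarrow> D) (at w)"
    and "summable (\<lambda>n. w ^ n *\<^sub>C x n)"
proof -
  have "0 < \<rho>"
    using w by (meson norm_ge_zero order_le_less_trans)
  then have \<rho>\<kappa>: "0 \<le> \<rho> * \<kappa>"
    using \<kappa> by simp
  have summ: "summable (\<lambda>n. z ^ n *\<^sub>C x n)" if z: "cmod z < \<rho>" for z
  proof (rule summable_comparison_test')
    show "summable (\<lambda>n. c * (\<rho> * \<kappa>) ^ n)"
      using \<rho> \<rho>\<kappa> by (intro summable_mult summable_geometric) simp
    show "norm (z ^ n *\<^sub>C x n) \<le> c * (\<rho> * \<kappa>) ^ n" for n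
    proof -
      have "norm (z ^ n *\<^sub>C x n) \<le> \<rho> ^ n * (c * \<kappa> ^ n)"
        unfolding norm_scaleC norm_power using z \<open>0 < \<rho>\<close> bound[of n]
        by (intro mult_mono power_mono) auto
      then show ?thesis
        by (simp add: power_mult_distrib mult_ac)
    qed
  qed
  then show "summable (\<lambda>n. w ^ n *\<^sub>C x n)"
    using w by blast
  define q where "q n v = (\<Sum>i<n. w ^ (n - Suc i) * v ^ i)" for n and v :: complex
  define M where "M n = real n * \<rho> ^ (n - 1) * (c * \<kappa> ^ n)" for n
  have "summable (\<lambda>n. M (Suc n))"
  proof -
    have "summable (\<lambda>n. c * \<kappa> * (of_nat (Suc n) * (\<rho> * \<kappa>) ^ n))"
      using geometric_deriv_sums[of "\<rho> * \<kappa>"] \<rho> \<rho>\<kappa> by (intro summable_mult) (auto simp: sums_iff)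
    then show ?thesis
      by (simp add: M_def power_mult_distrib mult_ac)
  qed
  then have sumM: "summable M"
    by (simp add: summable_Suc_iff)
  have qM: "norm (q n v *\<^sub>C x n) \<le> M n" if v: "v \<in> ball 0 \<rho>" for n v
  proof -
    have "cmod (q n v) \<le> (\<Sum>i<n. cmod (w ^ (n - Suc i) * v ^ i))"
      unfolding q_def by (rule norm_sum)
    also have "\<dots> \<le> (\<Sum>i<n. \<rho> ^ (n - 1))"
    proof (rule sum_mono)
      fix i assume i: "i \<in> {..<n}"
      have "cmod (w ^ (n - Suc i) * v ^ i) \<le> \<rho> ^ (n - Suc i) * \<rho> ^ i"
        unfolding norm_mult norm_power using w v \<open>0 < \<rho>\<close>
        by (intro mult_mono power_mono) auto
      also have "\<dots> = \<rho> ^ (n - 1)"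
        using i by (simp add: power_add[symmetric])
      finally show "cmod (w ^ (n - Suc i) * v ^ i) \<le> \<rho> ^ (n - 1)" .
    qed
    finally have "cmod (q n v) \<le> real n * \<rho> ^ (n - 1)"
      by simp
    then show ?thesis
      unfolding norm_scaleC M_def using bound[of n] \<open>0 < \<rho>\<close> by (intro mult_mono) auto
  qed
  define g where "g v = (\<Sum>n. q n v *\<^sub>C x n)" for v
  have lin: "bounded_linear (\<lambda>a. a *\<^sub>C u)" for u :: 'a
    using bounded_clinear_scaleC_vector[OF bounded_clinear_ident, of u] by (simp add: bounded_clinear_def)
  have "uniform_limit (ball 0 \<rho>) (\<lambda>n v. \<Sum>i<n. q i v *\<^sub>C x i) g sequentially"
    unfolding g_def by (rule Weierstrass_m_test[OF qM sumM])
  then have "continuous_on (ball 0 \<rho>) g"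
    by (rule uniform_limit_theorem[rotated])
      (auto simp: q_def intro!: always_eventually continuous_intros bounded_linear.continuous_on[OF lin])
  then have "isCont g w"
    using w by (simp add: continuous_on_eq_continuous_at)
  then have "(g \<longlongrightarrow> g w) (at w)"
    by (simp add: isCont_def)
  moreover have "\<forall>\<^sub>F v in at w. g v = inverse (v - w) *\<^sub>C (f v - f w)"
  proof -
    have "g v = inverse (v - w) *\<^sub>C (f v - f w)" if v: "v \<in> ball 0 \<rho>" "v \<noteq> w" for v
    proof -
      have "f v - f w = (\<Sum>n. v ^ n *\<^sub>C x n - w ^ n *\<^sub>C x n)"
        unfolding f_def using v w by (intro suminf_diff summ) auto
      also have "\<dots> = (\<Sum>n. (v - w) *\<^sub>C (q n v *\<^sub>C x n))"
      proof (rule suminf_cong)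
        fix n
        have "v ^ n *\<^sub>C x n - w ^ n *\<^sub>C x n = (v ^ n - w ^ n) *\<^sub>C x n"
          by (simp add: complex_vector.scale_left_diff_distrib)
        also have "v ^ n - w ^ n = (v - w) * q n v"
          by (simp add: q_def power_diff_sumr2)
        finally show "v ^ n *\<^sub>C x n - w ^ n *\<^sub>C x n = (v - w) *\<^sub>C (q n v *\<^sub>C x n)"
          by (simp add: scaleC_scaleC)
      qed
      also have "\<dots> = (v - w) *\<^sub>C g v"
      proof -
        have "bounded_linear (\<lambda>u::'a. (v - w) *\<^sub>C u)"
          by (rule bounded_linear_scaleC_right)
        moreover have "summable (\<lambda>n. q n v *\<^sub>C x n)"
          using qM[OF v(1)] by (intro summable_comparison_test'[OF sumM]) auto
        ultimately show ?thesis
          unfolding g_def by (rule bounded_linear.suminf[symmetric])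
      qed
      finally show ?thesis
        using v(2) by (simp add: scaleC_scaleC)
    qed
    moreover have "\<forall>\<^sub>F v in at w. v \<in> ball 0 \<rho>"
      using w by (intro eventually_at_in_open') auto
    moreover have "\<forall>\<^sub>F v in at w. v \<noteq> w"
      by (simp add: eventually_at_filter)
    ultimately show ?thesis
      by (auto elim: eventually_elim2)
  qed
  ultimately have "((\<lambda>v. inverse (v - w) *\<^sub>C (f v - f w)) \<longlongrightarrow> g w) (at w)"
    by (rule Lim_transform_eventually)
  then show "\<exists>D. ((\<lambda>v. inverse (v - w) *\<^sub>C (f v - f w)) \<longlongrightarrow> D) (at w)"
    by blast
qed

text \<open>The series \<open>f \<mu>\<close> of \<open>(\<mu> - z)^n x n\<close> satisfies \<open>T (f \<mu>) = \<mu> f \<mu>\<close>: applying \<open>T - z\<close> shifts the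
coefficients down, which amounts to multiplication by \<open>\<mu> - z\<close>. Its value at \<open>z\<close> is \<open>x 0\<close>.\<close>

lemma backward_orbit_not_SVEP:
  fixes T :: "'a::cbanach \<Rightarrow>\<^sub>C\<^sub>L 'a" and x :: "nat \<Rightarrow> 'a"
  assumes x0: "x 0 \<noteq> 0" "T *\<^sub>V x 0 = z *\<^sub>C x 0"
    and xS: "\<And>n. T *\<^sub>V x (Suc n) = z *\<^sub>C x (Suc n) + x n"
    and bound: "\<And>n. norm (x n) \<le> c * \<kappa> ^ n" and \<kappa>: "0 < \<kappa>"
  shows "\<not> SVEP_at T z"
proof
  assume "SVEP_at T z"
  then obtain r where r: "r > 0" "\<And>V f. open V \<Longrightarrow> V \<subseteq> ball z r \<Longrightarrow> vec_analytic_on f V \<Longrightarrow>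
      (\<forall>\<mu>\<in>V. (T - \<mu> *\<^sub>C id_cblinfun) *\<^sub>V f \<mu> = 0) \<Longrightarrow> (\<forall>\<mu>\<in>V. f \<mu> = 0)"
    unfolding SVEP_at_def by metis
  \<comment> \<open>A radius inside the disc of convergence and inside the disc on which the SVEP is assumed.\<close>
  define \<rho> where "\<rho> = min r (1 / (2 * \<kappa>))"
  have \<rho>: "0 < \<rho>" "\<rho> \<le> r" "\<rho> * \<kappa> < 1"
  proof -
    show "0 < \<rho>" "\<rho> \<le> r"
      using r(1) \<kappa> by (auto simp: \<rho>_def)
    have "\<rho> * \<kappa> \<le> (1 / (2 * \<kappa>)) * \<kappa>"
      using \<kappa> by (intro mult_right_mono) (auto simp: \<rho>_def)
    also have "\<dots> < 1"
      using \<kappa> by simp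
    finally show "\<rho> * \<kappa> < 1" .
  qed
  define F where "F v = (\<Sum>n. v ^ n *\<^sub>C x n)" for v
  note limF = power_series_quotient_limit(1)[OF bound less_imp_le[OF \<kappa>] \<rho>(3), folded F_def]
  note sumF = power_series_quotient_limit(2)[OF bound less_imp_le[OF \<kappa>] \<rho>(3)]
  define f where "f \<mu> = F (\<mu> - z)" for \<mu>
  have "vec_analytic_on f (ball z \<rho>)"
    unfolding vec_analytic_on_def
  proof
    fix u assume u: "u \<in> ball z \<rho>"
    then obtain e where e: "e > 0" "ball u e \<subseteq> ball z \<rho>"
      using open_contains_ball[of "ball z \<rho>"] open_ball by metis
    show "\<exists>e>0. \<forall>w\<in>ball u e. \<exists>D. ((\<lambda>v. inverse (v - w) *\<^sub>C (f v - f w)) \<longlongrightarrow> D) (at w)"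
    proof (intro exI[of _ e] conjI e(1) ballI)
      fix w assume "w \<in> ball u e"
      then have "cmod (w - z) < \<rho>"
        using e(2) by (auto simp: dist_norm norm_minus_commute)
      then obtain D where "((\<lambda>v. inverse (v - (w - z)) *\<^sub>C (F v - F (w - z))) \<longlongrightarrow> D) (at (w - z))"
        using limF by blast
      then have "((\<lambda>v. inverse (v - z - (w - z)) *\<^sub>C (F (v - z) - F (w - z))) \<longlongrightarrow> D) (at w)"
        by (rule tendsto_compose_eventually[of _ _ _ "\<lambda>v. v - z"])
          (auto intro!: tendsto_intros simp: eventually_at_filter)
      then show "\<exists>D. ((\<lambda>v. inverse (v - w) *\<^sub>C (f v - f w)) \<longlongrightarrow> D) (at w)"
        by (auto simp: f_def)
    qed
  qed
  moreover have "(T - \<mu> *\<^sub>C id_cblinfun) *\<^sub>V f \<mu> = 0" if \<mu>: "\<mu> \<in> ball z \<rho>" for \<mu>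
  proof -
    define y where "y = \<mu> - z"
    have y: "cmod y < \<rho>"
      using \<mu> by (simp add: y_def dist_norm norm_minus_commute)
    have s: "(\<lambda>n. y ^ n *\<^sub>C x n) sums F y"
      unfolding F_def by (rule summable_sums[OF sumF[OF y]])
    then have s': "(\<lambda>n. y ^ Suc n *\<^sub>C x (Suc n)) sums (F y - x 0)"
      using sums_Suc_iff[of "\<lambda>n. y ^ n *\<^sub>C x n" "F y - x 0"] by simp
    have "(\<lambda>n. T *\<^sub>V (y ^ Suc n *\<^sub>C x (Suc n))) sums (T *\<^sub>V (F y - x 0))"
      by (rule bounded_linear.sums[OF bounded_linear_cblinfun_apply s'])
    moreover have "(\<lambda>n. z *\<^sub>C (y ^ Suc n *\<^sub>C x (Suc n)) + y *\<^sub>C (y ^ n *\<^sub>C x n))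
        sums (z *\<^sub>C (F y - x 0) + y *\<^sub>C F y)"
      by (intro sums_add bounded_linear.sums[OF bounded_linear_scaleC_right] s s')
    moreover have "T *\<^sub>V (y ^ Suc n *\<^sub>C x (Suc n)) =
        z *\<^sub>C (y ^ Suc n *\<^sub>C x (Suc n)) + y *\<^sub>C (y ^ n *\<^sub>C x n)" for n
      by (simp add: cblinfun_linear xS scaleC_add_right scaleC_scaleC mult_ac)
    ultimately have "T *\<^sub>V (F y - x 0) = z *\<^sub>C (F y - x 0) + y *\<^sub>C F y"
      by (simp add: sums_unique2)
    then have "T *\<^sub>V F y = (z + y) *\<^sub>C F y"
      by (simp add: cblinfun_linear x0 complex_vector.scale_right_diff_distrib scaleC_add_left)
    then show ?thesis
      by (simp add: f_def y_def minus_cblinfun.rep_eq scaleC_cblinfun.rep_eq id_cblinfun.rep_eq)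
  qed
  ultimately have "f z = 0"
    using r(2)[of "ball z \<rho>" f] \<rho> by (simp add: subset_ball)
  moreover have "f z = x 0"
  proof -
    have "(\<lambda>n. (0::complex) ^ n *\<^sub>C x n) = (\<lambda>n. if n = 0 then x n else 0)"
      by (auto simp: power_0_left complex_vector.scale_zero_left)
    then show ?thesis
      unfolding f_def F_def using sums_single[of 0 x] by (simp add: sums_iff)
  qed
  ultimately show False
    using x0 by simp
qed

section \<open>Kernels of powers and the SVEP of the dual\<close>

lemma op_power_0_apply [simp]: "op_power T 0 *\<^sub>V x = x"
  by (simp add: id_cblinfun.rep_eq)

lemma op_power_Suc_apply: "op_power T (Suc n) *\<^sub>V x = T *\<^sub>V op_power T n *\<^sub>V x"
  by (simp add: cblinfun_compose.rep_eq)

declare op_power.simps [simp del]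

lemma op_power_add_apply: "op_power T (m + n) *\<^sub>V x = op_power T m *\<^sub>V op_power T n *\<^sub>V x"
  by (induction m) (simp_all add: op_power_Suc_apply)

lemma op_power_Suc_apply': "op_power T (Suc n) *\<^sub>V x = op_power T n *\<^sub>V T *\<^sub>V x"
  using op_power_add_apply[of T n 1 x] by (simp add: op_power_Suc_apply)

lemma op_power_commute:
  "op_power T m *\<^sub>V op_power T n *\<^sub>V x = op_power T n *\<^sub>V op_power T m *\<^sub>V x"
  by (simp add: op_power_add_apply[symmetric] add.commute)

lemma op_power_zero_mono: "op_power T m *\<^sub>V x = 0 \<Longrightarrow> m \<le> n \<Longrightarrow> op_power T n *\<^sub>V x = 0"
  using op_power_add_apply[of T "n - m" m x] by (simp add: cblinfun_linear)

lemma finite_dim_ker_power: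
  assumes "finite_dim (op_ker A)"
  shows "finite_dim (op_ker (op_power A n))"
proof (induction n)
  case 0
  show ?case
    by (rule finite_dimI[of "{}"]) (auto simp: op_ker_def)
next
  case (Suc n)
  show ?case
  proof (rule finite_dim_kernel_image[OF bounded_clinear_cblinfun_apply csubspace_op_ker])
    show "finite_dim (cblinfun_apply A ` op_ker (op_power A (Suc n)))"
      by (rule finite_dim_subset[OF Suc]) (auto simp: op_ker_def op_power_Suc_apply')
    show "finite_dim {x \<in> op_ker (op_power A (Suc n)). A *\<^sub>V x = 0}"
      by (rule finite_dim_subset[OF assms]) (auto simp: op_ker_def)
  qed
qed

text \<open>The intersections of the kernel of \<open>A\<close> with the ranges of its powers decrease inside a finite-dimensional
space, so they are constant from some \<open>m\<close> on. For \<open>n \<ge> m\<close> and \<open>y\<close> in the kernel of \<open>A^(n + 1)\<close>, the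
vector \<open>A^n y\<close> lies in such an intersection, hence equals \<open>A^(n + 1) u\<close>; so \<open>y\<close> agrees modulo the range
of \<open>A\<close> with a vector in the kernel of \<open>A^n\<close>. Descending to \<open>m\<close> gives the claim.\<close>

lemma ker_power_mod_range_stabilizes:
  assumes "finite_dim (op_ker A)"
  obtains m where "\<And>n y. op_power A n *\<^sub>V y = 0 \<Longrightarrow> \<exists>u. op_power A m *\<^sub>V (y - A *\<^sub>V u) = 0"
proof -
  define D where "D n = op_ker A \<inter> op_range (op_power A n)" for n
  have "csubspace (D n)" for n
    unfolding D_def by (intro complex_vector.subspace_inter csubspace_op_ker csubspace_op_range)
  moreover have "D (Suc n) \<subseteq> D n" for n
    by (auto simp: D_def op_range_def op_power_Suc_apply')
  moreover have "finite_dim (D 0)"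
    using assms by (rule finite_dim_subset) (simp add: D_def)
  ultimately obtain m where m: "\<And>n. n \<ge> m \<Longrightarrow> D n = D m"
    using decreasing_finite_dim_stabilizes[of D] by blast
  have step: "\<exists>u. op_power A n *\<^sub>V (y - A *\<^sub>V u) = 0"
    if n: "m \<le> n" and y: "op_power A (Suc n) *\<^sub>V y = 0" for n y
  proof -
    have "op_power A n *\<^sub>V y \<in> D n"
      using y by (auto simp: D_def op_ker_def op_range_def op_power_Suc_apply)
    also have "D n = D (Suc n)"
      using m[of n] m[of "Suc n"] n by simp
    finally obtain u where "op_power A n *\<^sub>V y = op_power A (Suc n) *\<^sub>V u"
      by (auto simp: D_def op_range_def)
    then show ?thesis
      by (auto simp: cblinfun_linear op_power_Suc_apply')
  qed
  have "\<exists>u. op_power A m *\<^sub>V (y - A *\<^sub>V u) = 0" if "op_power A (m + j) *\<^sub>V y = 0" for j y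
    using that
  proof (induction j arbitrary: y)
    case 0
    then show ?case
      by (intro exI[of _ 0]) (simp add: cblinfun_linear)
  next
    case (Suc j)
    obtain u where "op_power A (m + j) *\<^sub>V (y - A *\<^sub>V u) = 0"
      using step[of "m + j" y] Suc.prems by auto
    from Suc.IH[OF this] obtain u' where "op_power A m *\<^sub>V (y - A *\<^sub>V u - A *\<^sub>V u') = 0"
      by blast
    then show ?case
      by (intro exI[of _ "u + u'"]) (simp add: cblinfun_linear algebra_simps)
  qed
  then show thesis
    using that[of m] op_power_zero_mono[of A _ _] by (metis le_add2)
qed

lemma norm_cblinfun_bound: "norm (f *\<^sub>V x) \<le> norm f * norm x"
  unfolding norm_cblinfun.rep_eq by (rule onorm[OF bounded_linear_cblinfun_apply])

lemma norm_cblinfun_le: "0 \<le> b \<Longrightarrow> (\<And>x. norm (f *\<^sub>V x) \<le> b * norm x) \<Longrightarrow> norm f \<le> b"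
  unfolding norm_cblinfun.rep_eq by (rule onorm_bound)

lemma closed_range_plus_ker_power:
  assumes "A \<in> \<Phi>_plus"
  shows "closed ((\<lambda>v. A *\<^sub>V fst v + snd v) ` (UNIV \<times> op_ker (op_power A m)))"
proof -
  have A: "finite_dim (op_ker A)" "closed (op_range A)"
    using assms by (simp_all add: \<Phi>_plus_iff)
  obtain W where W: "finite W" "cspan W = op_ker (op_power A m)"
    using finite_dim_csubspace_eq_span[OF finite_dim_ker_power[OF A(1)] csubspace_op_ker] by metis
  have "(\<lambda>v. A *\<^sub>V fst v + snd v) ` (UNIV \<times> cspan W) = {x. \<exists>w\<in>cspan W. x - w \<in> op_range A}"
    by (force simp: op_range_def image_iff algebra_simps)
  then show ?thesis
    using closed_plus_span[OF csubspace_op_range A(2) W(1)] by (simp add: W(2))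
qed

text \<open>Let \<open>N\<close> be the kernel of \<open>A^m\<close>, with \<open>m\<close> the index of stabilization. On the closed sum of the range of \<open>A\<close> and
\<open>N\<close> put \<open>\<psi> (A x + k) = \<phi> x\<close>. This is well defined and bounded because \<open>\<phi>\<close> vanishes on the
kernel of \<open>A^(m + 1)\<close>: a representation with small \<open>x\<close> exists by the open mapping theorem, and all
representations give the same value. A Hahn--Banach extension still vanishes on the kernels of powers: such a
\<open>y\<close> is \<open>A u + k\<close> with \<open>k\<close> in \<open>N\<close>, so \<open>u\<close> lies in the kernel of a power too and \<open>\<psi> y = \<phi> u = 0\<close>.\<close>

lemma dual_preimage_annihilating_hyperkernel:
  fixes A :: "'a::cbanach \<Rightarrow>\<^sub>C\<^sub>L 'a"
  assumes A: "A \<in> \<Phi>_plus"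
  obtains \<kappa> where "0 < \<kappa>"
    "\<And>\<phi> :: 'a cdual. (\<And>n y. op_power A n *\<^sub>V y = 0 \<Longrightarrow> \<phi> *\<^sub>V y = 0) \<Longrightarrow>
      \<exists>\<psi> :: 'a cdual. (\<forall>n y. op_power A n *\<^sub>V y = 0 \<longrightarrow> \<psi> *\<^sub>V y = 0) \<and>
        (\<forall>x. \<psi> *\<^sub>V A *\<^sub>V x = \<phi> *\<^sub>V x) \<and> norm \<psi> \<le> \<kappa> * norm \<phi>"
proof -
  have "finite_dim (op_ker A)"
    using A by (simp add: \<Phi>_plus_iff)
  then obtain m where m: "\<And>n y. op_power A n *\<^sub>V y = 0 \<Longrightarrow> \<exists>u. op_power A m *\<^sub>V (y - A *\<^sub>V u) = 0"
    using ker_power_mod_range_stabilizes by blast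
  define N where "N = op_ker (op_power A m)"
  define V where "V = (UNIV :: 'a set) \<times> N"
  define \<Theta> where "\<Theta> = (\<lambda>v. A *\<^sub>V fst v + snd v)"
  have N: "csubspace N" "closed N"
    unfolding N_def using csubspace_op_ker
      closed_bounded_clinear_vimage[OF bounded_clinear_cblinfun_apply, of "{0}" "op_power A m"]
    by (auto simp: op_ker_def)
  have V: "csubspace V" "closed V"
    unfolding V_def using N by (simp_all add: csubspace_Times closed_Times complex_vector.subspace_UNIV)
  have "bounded_clinear \<Theta>"
    unfolding \<Theta>_def by (intro bounded_clinear_intros)
  then have bl: "bounded_linear \<Theta>"
    by (simp add: bounded_clinear_def)
  have "closed (\<Theta> ` V)"
    unfolding \<Theta>_def V_def N_def by (rule closed_range_plus_ker_power[OF A])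
  then obtain K where K: "0 \<le> K" "\<And>z. z \<in> \<Theta> ` V \<Longrightarrow> \<exists>v\<in>V. \<Theta> v = z \<and> norm v \<le> K * norm z"
    using open_mapping_closed_range[OF bl csubspace_imp_subspace[OF V(1)] V(2)] by metis
  show thesis
  proof
    \<comment> \<open>The summand 1 only serves to make the constant positive.\<close>
    show "0 < 2 * K + 1"
      using K by simp
    fix \<phi> :: "'a cdual"
    assume ann: "\<And>n y. op_power A n *\<^sub>V y = 0 \<Longrightarrow> \<phi> *\<^sub>V y = 0"
    \<comment> \<open>The graph of the partial functional \<open>\<psi>\<close>.\<close>
    define G where "G = (\<lambda>v. (\<Theta> v, \<phi> *\<^sub>V fst v)) ` V"
    have G: "csubspace G"
      unfolding G_def \<Theta>_def by (intro csubspace_image bounded_clinear_intros V)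
    have memG: "(A *\<^sub>V x + k, \<phi> *\<^sub>V x) \<in> G" if "op_power A m *\<^sub>V k = 0" for x k
      using that by (force simp: G_def V_def N_def op_ker_def \<Theta>_def)
    have dom: "cmod t \<le> (norm \<phi> * K) * norm z" if zt: "(z, t) \<in> G" for z t
    proof -
      obtain v where v: "v \<in> V" "z = \<Theta> v" "t = \<phi> *\<^sub>V fst v"
        using zt by (auto simp: G_def)
      then obtain v' where v': "v' \<in> V" "\<Theta> v' = z" "norm v' \<le> K * norm z"
        using K(2)[of z] by blast
      have "A *\<^sub>V (fst v - fst v') = snd v' - snd v"
        using v(2) v'(2) by (simp add: \<Theta>_def cblinfun_linear algebra_simps)
      moreover have "snd v' - snd v \<in> N"
        using v(1) v'(1) complex_vector.subspace_diff[OF N(1)] by (auto simp: V_def)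
      ultimately have "op_power A (Suc m) *\<^sub>V (fst v - fst v') = 0"
        by (simp add: op_power_Suc_apply' N_def op_ker_def)
      from ann[OF this] have "t = \<phi> *\<^sub>V fst v'"
        by (simp add: v cblinfun_linear)
      then have "cmod t \<le> norm \<phi> * norm (fst v')"
        using norm_cblinfun_bound by blast
      also have "\<dots> \<le> norm \<phi> * (K * norm z)"
        using v'(3) norm_fst_le[of "fst v'" "snd v'"] by (intro mult_left_mono) auto
      finally show ?thesis
        by (simp add: mult.assoc)
    qed
    have "0 \<le> norm \<phi> * K"
      using K by simp
    then obtain \<psi>0 where \<psi>0: "bounded_clinear \<psi>0" "\<And>z t. (z, t) \<in> G \<Longrightarrow> \<psi>0 z = t"
      "\<And>z. cmod (\<psi>0 z) \<le> 2 * (norm \<phi> * K) * norm z"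
      using complex_hahn_banach[OF G dom] by metis
    define \<psi> where "\<psi> = CBlinfun \<psi>0"
    have \<psi>: "\<psi> *\<^sub>V z = \<psi>0 z" for z
      using \<psi>0(1) by (simp add: \<psi>_def CBlinfun_inverse)
    have "\<psi> *\<^sub>V y = 0" if y: "op_power A n *\<^sub>V y = 0" for n y
    proof -
      obtain u where u: "op_power A m *\<^sub>V (y - A *\<^sub>V u) = 0"
        using m[OF y] by blast
      have "\<psi> *\<^sub>V y = \<phi> *\<^sub>V u"
        using \<psi>0(2)[OF memG[OF u, of u]] by (simp add: \<psi>)
      moreover have "op_power A (n + m) *\<^sub>V (y - (y - A *\<^sub>V u)) = 0"
        using op_power_zero_mono[OF y, of "n + m"] op_power_zero_mono[OF u, of "n + m"]
        by (simp only: cblinfun_linear(2)) simp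
      then have "op_power A (Suc (n + m)) *\<^sub>V u = 0"
        by (simp add: op_power_Suc_apply')
      ultimately show ?thesis
        using ann by metis
    qed
    moreover have "\<psi> *\<^sub>V A *\<^sub>V x = \<phi> *\<^sub>V x" for x
      using \<psi>0(2)[OF memG[of 0 x]] by (simp add: \<psi> cblinfun_linear)
    moreover have "norm \<psi> \<le> (2 * K + 1) * norm \<phi>"
    proof (rule norm_cblinfun_le)
      show "0 \<le> (2 * K + 1) * norm \<phi>"
        using K by simp
      fix z
      have "cmod (\<psi>0 z) \<le> (2 * K * norm \<phi>) * norm z"
        using \<psi>0(3)[of z] by (simp add: mult_ac)
      also have "\<dots> \<le> ((2 * K + 1) * norm \<phi>) * norm z"
        by (intro mult_right_mono) auto
      finally show "norm (\<psi> *\<^sub>V z) \<le> (2 * K + 1) * norm \<phi> * norm z"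
        by (simp add: \<psi>)
    qed
    ultimately show "\<exists>\<psi> :: 'a cdual. (\<forall>n y. op_power A n *\<^sub>V y = 0 \<longrightarrow> \<psi> *\<^sub>V y = 0) \<and>
        (\<forall>x. \<psi> *\<^sub>V A *\<^sub>V x = \<phi> *\<^sub>V x) \<and> norm \<psi> \<le> (2 * K + 1) * norm \<phi>"
      by blast
  qed
qed

text \<open>Otherwise a nonzero functional vanishes on the closed sum of the range and the kernel of the \<open>m\<close>-th power, which
contains the kernels of all powers. Iterated lifting through the dual operator then produces a backward orbit, so the dual
fails the SVEP.\<close>

lemma range_plus_ker_power_of_dual_SVEP:
  fixes A :: "'a::cbanach \<Rightarrow>\<^sub>C\<^sub>L 'a"
  assumes svep: "SVEP_at (dual_op A) z" and \<Phi>: "A - z *\<^sub>C id_cblinfun \<in> \<Phi>_plus"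
  obtains m where "\<And>x. \<exists>u. op_power (A - z *\<^sub>C id_cblinfun) m *\<^sub>V (x - (A - z *\<^sub>C id_cblinfun) *\<^sub>V u) = 0"
proof -
  define B where "B = A - z *\<^sub>C id_cblinfun"
  have AB: "A *\<^sub>V x = B *\<^sub>V x + z *\<^sub>C x" for x
    by (simp add: B_def minus_cblinfun.rep_eq scaleC_cblinfun.rep_eq id_cblinfun.rep_eq)
  have B: "B \<in> \<Phi>_plus" "finite_dim (op_ker B)"
    using \<Phi> by (simp_all add: B_def \<Phi>_plus_iff)
  obtain m where m: "\<And>n y. op_power B n *\<^sub>V y = 0 \<Longrightarrow> \<exists>u. op_power B m *\<^sub>V (y - B *\<^sub>V u) = 0"
    using ker_power_mod_range_stabilizes[OF B(2)] by blast
  define L where "L = (\<lambda>v. B *\<^sub>V fst v + snd v) ` (UNIV \<times> op_ker (op_power B m))"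
  have memL: "x \<in> L" if "op_power B m *\<^sub>V (x - B *\<^sub>V u) = 0" for x u
    unfolding L_def using that by (intro image_eqI[of _ _ "(u, x - B *\<^sub>V u)"]) (simp_all add: op_ker_def)
  have L: "\<exists>u. op_power B m *\<^sub>V (x - B *\<^sub>V u) = 0" if x: "x \<in> L" for x
  proof -
    obtain u k where "x = B *\<^sub>V u + k" "op_power B m *\<^sub>V k = 0"
      using x by (auto simp: L_def op_ker_def)
    then show ?thesis
      by (intro exI[of _ u]) simp
  qed
  have "L = UNIV"
  proof (rule ccontr)
    assume "L \<noteq> UNIV"
    then obtain v where v: "v \<notin> L"
      by blast
    have "csubspace L"
      unfolding L_def by (intro csubspace_image bounded_clinear_intros csubspace_Times csubspace_op_ker
          complex_vector.subspace_UNIV)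
    moreover have "closed L"
      unfolding L_def by (rule closed_range_plus_ker_power[OF B(1)])
    ultimately obtain \<phi> :: "'a \<Rightarrow> complex" where \<phi>: "bounded_clinear \<phi>" "\<And>x. x \<in> L \<Longrightarrow> \<phi> x = 0" "\<phi> v = 1"
      using separating_functional[OF _ _ v] by metis
    define \<phi>0 where "\<phi>0 = CBlinfun \<phi>"
    have \<phi>0: "\<phi>0 *\<^sub>V x = \<phi> x" for x
      using \<phi>(1) by (simp add: \<phi>0_def CBlinfun_inverse)
    define ann :: "'a cdual set" where "ann = {\<phi>. \<forall>n y. op_power B n *\<^sub>V y = 0 \<longrightarrow> \<phi> *\<^sub>V y = 0}"
    obtain \<kappa> where \<kappa>: "0 < \<kappa>" "\<And>\<phi>. \<phi> \<in> ann \<Longrightarrow>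
        \<exists>\<psi>. \<psi> \<in> ann \<and> (\<forall>x. \<psi> *\<^sub>V B *\<^sub>V x = \<phi> *\<^sub>V x) \<and> norm \<psi> \<le> \<kappa> * norm \<phi>"
      using dual_preimage_annihilating_hyperkernel[OF B(1)] unfolding ann_def mem_Collect_eq by metis
    then obtain lift where lift: "\<And>\<phi>. \<phi> \<in> ann \<Longrightarrow> lift \<phi> \<in> ann"
      "\<And>\<phi> x. \<phi> \<in> ann \<Longrightarrow> lift \<phi> *\<^sub>V B *\<^sub>V x = \<phi> *\<^sub>V x"
      "\<And>\<phi>. \<phi> \<in> ann \<Longrightarrow> norm (lift \<phi>) \<le> \<kappa> * norm \<phi>"
      by metis
    define \<Phi> where "\<Phi> n = (lift ^^ n) \<phi>0" for n
    have \<Phi>0: "\<Phi> 0 = \<phi>0" and \<Phi>S: "\<Phi> (Suc n) = lift (\<Phi> n)" for n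
      by (simp_all add: \<Phi>_def)
    have "\<phi>0 \<in> ann"
      unfolding ann_def using m memL \<phi>(2) by (auto simp: \<phi>0) metis
    then have \<Phi>ann: "\<Phi> n \<in> ann" for n
      by (induction n) (simp_all add: \<Phi>0 \<Phi>S lift)
    have dual: "dual_op A *\<^sub>V \<psi> = \<psi> o\<^sub>C\<^sub>L A" for \<psi>
      by (simp add: dual_op.rep_eq)
    have "\<not> SVEP_at (dual_op A) z"
    proof (rule backward_orbit_not_SVEP[of \<Phi>])
      have "\<phi>0 *\<^sub>V v = 1"
        by (simp add: \<phi>0 \<phi>)
      then show "\<Phi> 0 \<noteq> 0"
        by (auto simp: \<Phi>0 zero_cblinfun.rep_eq)
      have "B *\<^sub>V x \<in> L" for x
        by (rule memL[of _ x]) (simp add: cblinfun_linear)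
      then show "dual_op A *\<^sub>V \<Phi> 0 = z *\<^sub>C \<Phi> 0"
        by (intro cblinfun_eqI)
          (simp add: dual cblinfun_compose.rep_eq scaleC_cblinfun.rep_eq AB cblinfun_linear \<Phi>0 \<phi>0 \<phi>
            bounded_clinearD[OF \<phi>(1)])
      show "dual_op A *\<^sub>V \<Phi> (Suc n) = z *\<^sub>C \<Phi> (Suc n) + \<Phi> n" for n
        by (intro cblinfun_eqI)
          (simp add: dual cblinfun_compose.rep_eq scaleC_cblinfun.rep_eq plus_cblinfun.rep_eq AB
            cblinfun_linear \<Phi>S lift(2)[OF \<Phi>ann])
      show "norm (\<Phi> n) \<le> norm \<phi>0 * \<kappa> ^ n" for n
      proof (induction n)
        case (Suc n)
        have "norm (\<Phi> (Suc n)) \<le> \<kappa> * norm (\<Phi> n)"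
          unfolding \<Phi>S by (rule lift(3)[OF \<Phi>ann])
        also have "\<dots> \<le> \<kappa> * (norm \<phi>0 * \<kappa> ^ n)"
          using Suc \<kappa>(1) by (intro mult_left_mono) auto
        finally show ?case
          by (simp add: mult_ac)
      qed (simp add: \<Phi>0)
    qed (rule \<kappa>(1))
    then show False
      using svep by simp
  qed
  then show thesis
    using that[of m] L unfolding B_def by blast
qed

section \<open>Left inverses and ascent\<close>

lemma left_invertible_iff:
  "left_invertible T \<longleftrightarrow> (\<exists>S. bounded_clinear S \<and> (\<forall>x. S (T *\<^sub>V x) = x))"
proof
  assume "left_invertible T"
  then obtain S where S: "S o\<^sub>C\<^sub>L T = id_cblinfun"
    by (auto simp: left_invertible_def)
  have "S *\<^sub>V T *\<^sub>V x = x" for x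
    by (metis S cblinfun_compose.rep_eq id_cblinfun.rep_eq)
  then show "\<exists>S. bounded_clinear S \<and> (\<forall>x. S (T *\<^sub>V x) = x)"
    using bounded_clinear_cblinfun_apply by blast
next
  assume "\<exists>S. bounded_clinear S \<and> (\<forall>x. S (T *\<^sub>V x) = x)"
  then obtain S where S: "bounded_clinear S" "\<And>x. S (T *\<^sub>V x) = x"
    by blast
  have "CBlinfun S o\<^sub>C\<^sub>L T = id_cblinfun"
    using S by (intro cblinfun_eqI) (simp add: cblinfun_compose.rep_eq id_cblinfun.rep_eq CBlinfun_inverse)
  then show "left_invertible T"
    by (auto simp: left_invertible_def)
qed

lemma left_invertible_imp_\<Phi>_l:
  fixes T :: "'a::cbanach \<Rightarrow>\<^sub>C\<^sub>L 'a"
  assumes "left_invertible T"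
  shows "T \<in> \<Phi>_l" "op_ker T = {0}"
proof -
  obtain S where S: "bounded_clinear S" "\<And>x. S (T *\<^sub>V x) = x"
    using assms by (auto simp: left_invertible_iff)
  have "finite_rank (\<lambda>x. S (T *\<^sub>V x) - x)"
    unfolding S(2) finite_rank_def by (rule finite_dimI[of "{}"]) auto
  then show "T \<in> \<Phi>_l"
    by (rule \<Phi>_l_of_regularizer[OF S(1)])
  have "x = 0" if "T *\<^sub>V x = 0" for x
    using S(2)[of x] that by (simp add: bounded_clinearD[OF S(1)])
  then show "op_ker T = {0}"
    by (auto simp: op_ker_def cblinfun_linear)
qed

text \<open>This form speaks of all powers at once, so it passes to restrictions and quotients without any bookkeeping of indices.\<close>

lemma asc_finite_iff: "asc T < \<infinity> \<longleftrightarrow> (\<exists>k. \<forall>n x. op_power T n *\<^sub>V x = 0 \<longrightarrow> op_power T k *\<^sub>V x = 0)"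
proof -
  have "asc T < \<infinity> \<longleftrightarrow> (\<exists>k. op_ker (op_power T k) = op_ker (op_power T (Suc k)))"
    by (simp add: asc_def)
  also have "\<dots> \<longleftrightarrow> (\<exists>k. \<forall>n x. op_power T n *\<^sub>V x = 0 \<longrightarrow> op_power T k *\<^sub>V x = 0)"
  proof (intro ex_cong1 iffI allI impI)
    fix k n x
    assume k: "op_ker (op_power T k) = op_ker (op_power T (Suc k))" and x: "op_power T n *\<^sub>V x = 0"
    have down: "op_power T k *\<^sub>V y = 0" if "op_power T (k + j) *\<^sub>V y = 0" for j y
      using that
    proof (induction j arbitrary: y)
      case (Suc j)
      then have "op_power T k *\<^sub>V T *\<^sub>V y = 0"
        using Suc.IH[of "T *\<^sub>V y"] by (simp add: op_power_Suc_apply')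
      then show ?case
        using k by (auto simp: op_ker_def op_power_Suc_apply')
    qed simp
    show "op_power T k *\<^sub>V x = 0"
      using down[of n x] op_power_zero_mono[OF x, of "k + n"] by simp
  next
    fix k
    assume "\<forall>n x. op_power T n *\<^sub>V x = 0 \<longrightarrow> op_power T k *\<^sub>V x = 0"
    then show "op_ker (op_power T k) = op_ker (op_power T (Suc k))"
      using op_power_zero_mono[of T k _ "Suc k"] by (auto simp: op_ker_def)
  qed
  finally show ?thesis .
qed

section \<open>Upper triangular operators\<close>

lemma upper_tri_op_apply: "upper_tri_op A C B *\<^sub>V z = (A *\<^sub>V fst z + C *\<^sub>V snd z, B *\<^sub>V snd z)"
  by (simp add: upper_tri_op.rep_eq)

lemma upper_tri_op_minus_scalar:
  "upper_tri_op A C B - z *\<^sub>C id_cblinfun =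
    upper_tri_op (A - z *\<^sub>C id_cblinfun) C (B - z *\<^sub>C id_cblinfun)"
  by (intro cblinfun_eqI)
    (simp add: upper_tri_op_apply minus_cblinfun.rep_eq scaleC_cblinfun.rep_eq id_cblinfun.rep_eq
      scaleC_prod_def prod_eq_iff)

lemma op_power_upper_tri_fst:
  "op_power (upper_tri_op A C B) n *\<^sub>V (x, 0) = (op_power A n *\<^sub>V x, 0)"
  by (induction n arbitrary: x) (simp_all add: op_power_Suc_apply upper_tri_op_apply cblinfun_linear)

lemma snd_op_power_upper_tri:
  "snd (op_power (upper_tri_op A C B) n *\<^sub>V z) = op_power B n *\<^sub>V snd z"
  by (induction n) (simp_all add: op_power_Suc_apply upper_tri_op_apply)

text \<open>The estimate for \<open>B\<close> bounds the second component, which in turn bounds the error \<open>C y\<close> made when the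
estimate for \<open>A\<close> is applied to the first component.\<close>

lemma \<Phi>_plus_upper_tri:
  fixes A :: "'x::cbanach \<Rightarrow>\<^sub>C\<^sub>L 'x" and B :: "'y::cbanach \<Rightarrow>\<^sub>C\<^sub>L 'y"
  assumes "A \<in> \<Phi>_plus" "B \<in> \<Phi>_plus"
  shows "upper_tri_op A C B \<in> \<Phi>_plus"
proof -
  obtain P K where P: "bounded_clinear P" "finite_rank P" "0 \<le> K"
    "\<And>x. norm x \<le> K * norm (A *\<^sub>V x) + norm (P x :: 'x)"
    using \<Phi>_plus_estimate[OF assms(1)] by metis
  obtain Q L where Q: "bounded_clinear Q" "finite_rank Q" "0 \<le> L"
    "\<And>y. norm y \<le> L * norm (B *\<^sub>V y) + norm (Q y :: 'y)"
    using \<Phi>_plus_estimate[OF assms(2)] by metis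
  define F where "F z = (P (fst z), Q (snd z))" for z
  show ?thesis
  proof (rule \<Phi>_plus_of_estimate)
    show "bounded_clinear F"
      unfolding F_def by (intro bounded_clinear_intros bounded_clinear_compose[OF P(1)]
          bounded_clinear_compose[OF Q(1)])
    show "finite_rank F"
      unfolding F_def by (intro finite_rank_Pair finite_rank_precompose[OF P(2)] finite_rank_precompose[OF Q(2)])
    fix z :: "'x \<times> 'y"
    define m where "m = norm (upper_tri_op A C B *\<^sub>V z)"
    define f where "f = norm (F z)"
    define c where "c = K * norm C"
    have c: "0 \<le> c"
      using P(3) by (simp add: c_def)
    have Ax: "norm (A *\<^sub>V fst z + C *\<^sub>V snd z) \<le> m" and By: "norm (B *\<^sub>V snd z) \<le> m"
      unfolding m_def upper_tri_op_apply by (rule norm_fst_le norm_snd_le)+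
    have Px: "norm (P (fst z)) \<le> f" and Qy: "norm (Q (snd z)) \<le> f"
      unfolding f_def F_def by (rule norm_fst_le norm_snd_le)+
    have y: "norm (snd z) \<le> L * m + f"
      using Q(4)[of "snd z"] Qy mult_left_mono[OF By Q(3)] by linarith
    have "norm (A *\<^sub>V fst z) \<le> norm (A *\<^sub>V fst z + C *\<^sub>V snd z) + norm (C *\<^sub>V snd z)"
      by (metis add_diff_cancel_right' norm_triangle_ineq4)
    then have "norm (A *\<^sub>V fst z) \<le> m + norm C * norm (snd z)"
      using Ax norm_cblinfun_bound[of C "snd z"] by linarith
    from mult_left_mono[OF this P(3)] have "K * norm (A *\<^sub>V fst z) \<le> K * m + c * norm (snd z)"
      by (simp add: c_def algebra_simps)
    then have x: "norm (fst z) \<le> K * m + c * norm (snd z) + f"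
      using P(4)[of "fst z"] Px by linarith
    have "c * norm (snd z) \<le> c * (L * m + f)"
      by (rule mult_left_mono[OF y c])
    then have "norm (fst z) + norm (snd z) \<le> (K + c * L + L) * m + (c + 2) * f"
      using x y by (simp add: algebra_simps)
    moreover have "norm z \<le> norm (fst z) + norm (snd z)"
      using norm_Pair_le[of "fst z" "snd z"] by simp
    ultimately show "norm z \<le> (K + c * L + L) * norm (upper_tri_op A C B *\<^sub>V z) + (c + 2) * norm (F z)"
      by (simp add: m_def f_def)
  qed
qed

lemma \<Phi>_plus_upper_tri_fst:
  fixes A :: "'x::cbanach \<Rightarrow>\<^sub>C\<^sub>L 'x" and B :: "'y::cbanach \<Rightarrow>\<^sub>C\<^sub>L 'y"
  assumes "upper_tri_op A C B \<in> \<Phi>_plus"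
  shows "A \<in> \<Phi>_plus"
proof -
  obtain P K where P: "bounded_clinear P" "finite_rank P"
    "\<And>z. norm z \<le> K * norm (upper_tri_op A C B *\<^sub>V z) + norm (P z :: 'x \<times> 'y)"
    using \<Phi>_plus_estimate[OF assms] by metis
  show ?thesis
  proof (rule \<Phi>_plus_of_estimate)
    show "bounded_clinear (\<lambda>x. P (x, 0))"
      by (intro bounded_clinear_compose[OF P(1)] bounded_clinear_intros)
    show "finite_rank (\<lambda>x. P (x, 0))"
      by (rule finite_rank_precompose[OF P(2)])
    show "norm x \<le> K * norm (A *\<^sub>V x) + 1 * norm (P (x, 0))" for x
      using P(3)[of "(x, 0)"] by (simp add: upper_tri_op_apply cblinfun_linear)
  qed
qed

text \<open>The vector \<open>w y = (- S (C y), y)\<close> is at least as long as \<open>y\<close> and is mapped to \<open>(0, B y)\<close> up to the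
finite-rank term \<open>R y\<close>, so the estimate for the matrix at \<open>w y\<close> is one for \<open>B\<close> at \<open>y\<close>.\<close>

lemma \<Phi>_plus_upper_tri_snd:
  fixes A :: "'x::cbanach \<Rightarrow>\<^sub>C\<^sub>L 'x" and B :: "'y::cbanach \<Rightarrow>\<^sub>C\<^sub>L 'y"
  assumes M: "upper_tri_op A C B \<in> \<Phi>_plus"
    and S: "bounded_clinear S" "finite_rank (\<lambda>x. A *\<^sub>V S x - x)"
  shows "B \<in> \<Phi>_plus"
proof -
  obtain P K where P: "bounded_clinear P" "finite_rank P" "0 \<le> K"
    "\<And>z. norm z \<le> K * norm (upper_tri_op A C B *\<^sub>V z) + norm (P z :: 'x \<times> 'y)"
    using \<Phi>_plus_estimate[OF M] by metis
  define R where "R y = A *\<^sub>V S (C *\<^sub>V y) - C *\<^sub>V y" for y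
  define w where "w y = (- S (C *\<^sub>V y), y)" for y
  define F where "F y = (R y, P (w y))" for y
  have w: "bounded_clinear w"
    unfolding w_def by (intro bounded_clinear_intros bounded_clinear_compose[OF S(1)])
  have Mw: "upper_tri_op A C B *\<^sub>V w y = (- R y, B *\<^sub>V y)" for y
    by (simp add: upper_tri_op_apply w_def R_def cblinfun_linear)
  show ?thesis
  proof (rule \<Phi>_plus_of_estimate)
    show "bounded_clinear F"
      unfolding F_def R_def
      by (intro bounded_clinear_intros bounded_clinear_compose[OF S(1)] bounded_clinear_compose[OF P(1) w])
    have "finite_rank R"
      unfolding R_def by (rule finite_rank_precompose[OF S(2)])
    then show "finite_rank F"
      unfolding F_def by (intro finite_rank_Pair finite_rank_precompose[OF P(2)])
    fix y
    have "norm y \<le> norm (w y)"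
      using norm_snd_le[of y "- S (C *\<^sub>V y)"] by (simp add: w_def)
    also have "\<dots> \<le> K * norm (- R y, B *\<^sub>V y) + norm (P (w y))"
      using P(4)[of "w y"] by (simp add: Mw)
    also have "\<dots> \<le> K * (norm (R y) + norm (B *\<^sub>V y)) + norm (P (w y))"
      using P(3) norm_Pair_le[of "- R y" "B *\<^sub>V y"] by (intro add_right_mono mult_left_mono) auto
    also have "\<dots> \<le> K * (norm (F y) + norm (B *\<^sub>V y)) + norm (F y)"
      using P(3) norm_fst_le[of "R y" "P (w y)"] norm_snd_le[of "P (w y)" "R y"]
      by (intro add_mono mult_left_mono) (auto simp: F_def)
    finally show "norm y \<le> K * norm (B *\<^sub>V y) + (K + 1) * norm (F y)"
      by (simp add: algebra_simps)
  qed
qed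

text \<open>The matrix with rows \<open>(S, - S C T)\<close> and \<open>(0, T)\<close> is the exact inverse when \<open>S\<close> and \<open>T\<close> are, and
the deviation from the identity depends on the two defects only through bounded maps.\<close>

lemma \<Phi>_l_upper_tri:
  fixes A :: "'x::cbanach \<Rightarrow>\<^sub>C\<^sub>L 'x" and B :: "'y::cbanach \<Rightarrow>\<^sub>C\<^sub>L 'y"
  assumes "A \<in> \<Phi>_l" "B \<in> \<Phi>_l"
  shows "upper_tri_op A C B \<in> \<Phi>_l"
proof -
  obtain S where S: "bounded_clinear S" "finite_rank (\<lambda>x. S (A *\<^sub>V x) - x)"
    using \<Phi>_l_regularizer[OF assms(1)] by metis
  obtain T where T: "bounded_clinear T" "finite_rank (\<lambda>y. T (B *\<^sub>V y) - y)"
    using \<Phi>_l_regularizer[OF assms(2)] by metis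
  define U where "U z = (S (fst z) - S (C *\<^sub>V T (snd z)), T (snd z))" for z
  show ?thesis
  proof (rule \<Phi>_l_of_regularizer)
    show "bounded_clinear U"
      unfolding U_def by (intro bounded_clinear_intros bounded_clinear_compose[OF S(1)]
          bounded_clinear_compose[OF T(1)])
    have "U (upper_tri_op A C B *\<^sub>V z) - z =
        ((S (A *\<^sub>V fst z) - fst z) - S (C *\<^sub>V (T (B *\<^sub>V snd z) - snd z)), T (B *\<^sub>V snd z) - snd z)" for z
      by (simp add: U_def upper_tri_op_apply prod_eq_iff bounded_clinearD[OF S(1)] cblinfun_linear)
    moreover have "finite_rank (\<lambda>z :: 'x \<times> 'y. ((S (A *\<^sub>V fst z) - fst z) -
        S (C *\<^sub>V (T (B *\<^sub>V snd z) - snd z)), T (B *\<^sub>V snd z) - snd z))"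
      by (intro finite_rank_Pair finite_rank_diff finite_rank_precompose[OF S(2)]
          finite_rank_precompose[OF T(2)] finite_rank_postcompose[OF S(1)]
          finite_rank_postcompose[OF bounded_clinear_cblinfun_apply])
    ultimately show "finite_rank (\<lambda>z. U (upper_tri_op A C B *\<^sub>V z) - z)"
      by simp
  qed
qed

lemma \<Phi>_l_upper_tri_fst:
  fixes A :: "'x::cbanach \<Rightarrow>\<^sub>C\<^sub>L 'x" and B :: "'y::cbanach \<Rightarrow>\<^sub>C\<^sub>L 'y"
  assumes "upper_tri_op A C B \<in> \<Phi>_l"
  shows "A \<in> \<Phi>_l"
proof -
  obtain S where S: "bounded_clinear S" "finite_rank (\<lambda>z. S (upper_tri_op A C B *\<^sub>V z) - z)"
    using \<Phi>_l_regularizer[OF assms] by metis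
  show ?thesis
  proof (rule \<Phi>_l_of_regularizer)
    show "bounded_clinear (\<lambda>x. fst (S (x, 0)))"
      by (intro bounded_clinear_intros bounded_clinear_compose[OF S(1)])
    have "finite_rank (\<lambda>x. fst (S (upper_tri_op A C B *\<^sub>V (x, 0)) - (x, 0)))"
      by (intro finite_rank_postcompose[OF bounded_clinear_fst[OF bounded_clinear_ident]]
          finite_rank_precompose[OF S(2)])
    then show "finite_rank (\<lambda>x. fst (S (A *\<^sub>V x, 0)) - x)"
      by (simp add: upper_tri_op_apply cblinfun_linear)
  qed
qed

text \<open>The lower right corner of a regularizer \<open>S\<close> of the matrix works. To see this, evaluate \<open>S\<close> along
\<open>w y = (- R (C y), y)\<close>, which the matrix maps to \<open>(0, B y)\<close> up to finite rank.\<close>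

lemma \<Phi>_l_upper_tri_snd:
  fixes A :: "'x::cbanach \<Rightarrow>\<^sub>C\<^sub>L 'x" and B :: "'y::cbanach \<Rightarrow>\<^sub>C\<^sub>L 'y"
  assumes M: "upper_tri_op A C B \<in> \<Phi>_l"
    and R: "bounded_clinear R" "finite_rank (\<lambda>x. A *\<^sub>V R x - x)"
  shows "B \<in> \<Phi>_l"
proof -
  obtain S where S: "bounded_clinear S" "finite_rank (\<lambda>z. S (upper_tri_op A C B *\<^sub>V z) - z)"
    using \<Phi>_l_regularizer[OF M] by metis
  define w where "w y = (- R (C *\<^sub>V y), y)" for y
  show ?thesis
  proof (rule \<Phi>_l_of_regularizer)
    show "bounded_clinear (\<lambda>y. snd (S (0, y)))"
      by (intro bounded_clinear_intros bounded_clinear_compose[OF S(1)])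
    have split: "S (0, B *\<^sub>V y) - (0, y) = (S (upper_tri_op A C B *\<^sub>V w y) - w y)
        + (S (A *\<^sub>V R (C *\<^sub>V y) - C *\<^sub>V y, 0) + (- R (C *\<^sub>V y), 0))" for y
    proof -
      have "(0, B *\<^sub>V y) = upper_tri_op A C B *\<^sub>V w y + (A *\<^sub>V R (C *\<^sub>V y) - C *\<^sub>V y, 0)"
        by (simp add: upper_tri_op_apply w_def cblinfun_linear)
      then have "S (0, B *\<^sub>V y) = S (upper_tri_op A C B *\<^sub>V w y) + S (A *\<^sub>V R (C *\<^sub>V y) - C *\<^sub>V y, 0)"
        by (simp only: bounded_clinearD[OF S(1)])
      then show ?thesis
        by (simp add: w_def prod_eq_iff)
    qed
    have "snd (S (0, B *\<^sub>V y)) - y = snd (S (upper_tri_op A C B *\<^sub>V w y) - w y)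
        + snd (S (A *\<^sub>V R (C *\<^sub>V y) - C *\<^sub>V y, 0))" for y
      using arg_cong[OF split, of snd y] by simp
    moreover have "finite_rank (\<lambda>y. snd (S (upper_tri_op A C B *\<^sub>V w y) - w y)
        + snd (S (A *\<^sub>V R (C *\<^sub>V y) - C *\<^sub>V y, 0)))"
      by (intro finite_rank_add finite_rank_precompose[OF S(2)] finite_rank_precompose[OF R(2)]
          finite_rank_postcompose[OF bounded_clinear_snd[OF bounded_clinear_ident]]
          finite_rank_postcompose[of "\<lambda>x. snd (S (x, 0))"] bounded_clinear_snd
          bounded_clinear_compose[OF S(1)] bounded_clinear_intros)
    ultimately show "finite_rank (\<lambda>y. snd (S (0, B *\<^sub>V y)) - y)"
      by simp
  qed
qed

lemma left_invertible_upper_tri: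
  assumes "left_invertible A" "left_invertible B"
  shows "left_invertible (upper_tri_op A C B)"
proof -
  obtain S T where S: "bounded_clinear S" "\<And>x. S (A *\<^sub>V x) = x"
    and T: "bounded_clinear T" "\<And>y. T (B *\<^sub>V y) = y"
    using assms by (auto simp: left_invertible_iff)
  have "bounded_clinear (\<lambda>z. (S (fst z) - S (C *\<^sub>V T (snd z)), T (snd z)))"
    by (intro bounded_clinear_intros bounded_clinear_compose[OF S(1)] bounded_clinear_compose[OF T(1)])
  then show ?thesis
    unfolding left_invertible_iff
    by (intro exI[of _ "\<lambda>z. (S (fst z) - S (C *\<^sub>V T (snd z)), T (snd z))"] conjI)
      (auto simp: upper_tri_op_apply bounded_clinearD[OF S(1)] S(2) T(2))
qed

lemma left_invertible_upper_tri_fst: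
  assumes "left_invertible (upper_tri_op A C B)"
  shows "left_invertible A"
proof -
  obtain S where S: "bounded_clinear S" "\<And>z. S (upper_tri_op A C B *\<^sub>V z) = z"
    using assms by (auto simp: left_invertible_iff)
  have "bounded_clinear (\<lambda>x. fst (S (x, 0)))"
    by (intro bounded_clinear_intros bounded_clinear_compose[OF S(1)])
  moreover have "fst (S (A *\<^sub>V x, 0)) = x" for x
    using S(2)[of "(x, 0)"] by (simp add: upper_tri_op_apply cblinfun_linear)
  ultimately show ?thesis
    unfolding left_invertible_iff by blast
qed

text \<open>Surjectivity of \<open>A\<close> allows the upper entry \<open>C y\<close> of the image of \<open>(0, y)\<close> to be cancelled exactly.\<close>

lemma left_invertible_upper_tri_snd:
  assumes M: "left_invertible (upper_tri_op A C B)" and surj: "\<And>x. \<exists>u. A *\<^sub>V u = x"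
  shows "left_invertible B"
proof -
  obtain S where S: "bounded_clinear S" "\<And>z. S (upper_tri_op A C B *\<^sub>V z) = z"
    using M by (auto simp: left_invertible_iff)
  have "bounded_clinear (\<lambda>y. snd (S (0, y)))"
    by (intro bounded_clinear_intros bounded_clinear_compose[OF S(1)])
  moreover have "snd (S (0, B *\<^sub>V y)) = y" for y
  proof -
    obtain u where "A *\<^sub>V u = - (C *\<^sub>V y)"
      using surj by blast
    then show ?thesis
      using S(2)[of "(u, y)"] by (simp add: upper_tri_op_apply)
  qed
  ultimately show ?thesis
    unfolding left_invertible_iff by blast
qed

text \<open>A vector annihilated by a power of the matrix falls into the first summand after \<open>b\<close> steps, where the
ascent of \<open>A\<close> takes over; this gives the bound \<open>a + b\<close>.\<close>

lemma asc_upper_tri: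
  assumes "asc A < \<infinity>" "asc B < \<infinity>"
  shows "asc (upper_tri_op A C B) < \<infinity>"
proof -
  let ?M = "upper_tri_op A C B"
  obtain a b where a: "\<And>n x. op_power A n *\<^sub>V x = 0 \<Longrightarrow> op_power A a *\<^sub>V x = 0"
    and b: "\<And>n y. op_power B n *\<^sub>V y = 0 \<Longrightarrow> op_power B b *\<^sub>V y = 0"
    using assms unfolding asc_finite_iff by metis
  have "op_power ?M (a + b) *\<^sub>V z = 0" if z: "op_power ?M n *\<^sub>V z = 0" for n z
  proof -
    have "op_power B n *\<^sub>V snd z = 0"
      using z snd_op_power_upper_tri[of A C B n z] by simp
    then have "snd (op_power ?M b *\<^sub>V z) = 0"
      using b by (simp add: snd_op_power_upper_tri)
    then obtain x where x: "op_power ?M b *\<^sub>V z = (x, 0)"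
      by (metis prod.collapse)
    have "op_power ?M n *\<^sub>V (x, 0) = 0"
      unfolding x[symmetric] op_power_commute[of _ n b] z by (rule cblinfun_linear(4))
    then have "op_power A a *\<^sub>V x = 0"
      using a[of n x] by (simp add: op_power_upper_tri_fst zero_prod_def)
    then show ?thesis
      by (simp add: op_power_add_apply x op_power_upper_tri_fst zero_prod_def)
  qed
  then show ?thesis
    unfolding asc_finite_iff by blast
qed

lemma asc_upper_tri_fst:
  assumes "asc (upper_tri_op A C B) < \<infinity>"
  shows "asc A < \<infinity>"
proof -
  obtain a where a: "\<And>n z. op_power (upper_tri_op A C B) n *\<^sub>V z = 0 \<Longrightarrow>
      op_power (upper_tri_op A C B) a *\<^sub>V z = 0"
    using assms unfolding asc_finite_iff by metis
  have "op_power A a *\<^sub>V x = 0" if "op_power A n *\<^sub>V x = 0" for n x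
    using a[of n "(x, 0)"] that by (simp add: op_power_upper_tri_fst zero_prod_def)
  then show ?thesis
    unfolding asc_finite_iff by blast
qed

text \<open>If \<open>B^n y = 0\<close>, then \<open>M^n (0, y) = (x, 0)\<close> for some \<open>x\<close>. By finite descent \<open>A^m x = A^(m + n) u\<close>,
so \<open>(- u, y)\<close> is annihilated by \<open>M^(m + n)\<close> and therefore already by \<open>M^a\<close>; its second component
gives \<open>B^a y = 0\<close>.\<close>

lemma asc_upper_tri_snd:
  assumes "asc (upper_tri_op A C B) < \<infinity>"
    and desc: "\<And>x. \<exists>u. op_power A m *\<^sub>V x = op_power A (Suc m) *\<^sub>V u"
  shows "asc B < \<infinity>"
proof -
  let ?M = "upper_tri_op A C B"
  obtain a where a: "\<And>n z. op_power ?M n *\<^sub>V z = 0 \<Longrightarrow> op_power ?M a *\<^sub>V z = 0"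
    using assms(1) unfolding asc_finite_iff by metis
  have range: "\<exists>u. op_power A m *\<^sub>V x = op_power A (m + n) *\<^sub>V u" for n x
  proof (induction n)
    case (Suc n)
    then obtain u where u: "op_power A m *\<^sub>V x = op_power A (n + m) *\<^sub>V u"
      by (auto simp: add.commute)
    obtain v where "op_power A m *\<^sub>V u = op_power A (Suc m) *\<^sub>V v"
      using desc by blast
    then have "op_power A m *\<^sub>V x = op_power A (n + Suc m) *\<^sub>V v"
      unfolding u op_power_add_apply by simp
    then show ?case
      by (auto simp: add_ac)
  qed auto
  have "op_power B a *\<^sub>V y = 0" if y: "op_power B n *\<^sub>V y = 0" for n y
  proof -
    have "snd (op_power ?M n *\<^sub>V (0, y)) = 0"
      using y by (simp add: snd_op_power_upper_tri)
    then obtain x where x: "op_power ?M n *\<^sub>V (0, y) = (x, 0)"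
      by (metis prod.collapse)
    obtain u where u: "op_power A m *\<^sub>V x = op_power A (m + n) *\<^sub>V u"
      using range by blast
    have "op_power ?M (m + n) *\<^sub>V ((0, y) - (u, 0)) =
        op_power ?M m *\<^sub>V (x, 0) - op_power ?M (m + n) *\<^sub>V (u, 0)"
      unfolding cblinfun_linear(2) op_power_add_apply[of _ m n "(0, y)"] x ..
    also have "\<dots> = 0"
      by (simp add: op_power_upper_tri_fst u)
    finally have "op_power ?M a *\<^sub>V ((0, y) - (u, 0)) = 0"
      by (rule a)
    then show ?thesis
      using snd_op_power_upper_tri[of A C B a "(0, y) - (u, 0)"] by simp
  qed
  then show ?thesis
    unfolding asc_finite_iff by blast
qed

section \<open>Consequences of the SVEP of the dual\<close>

text \<open>The next three lemmas exploit a decomposition of the whole space into the range of \<open>A\<close> and the kernel of \<open>A^m\<close>.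
It is stated as: every \<open>x\<close> differs from some \<open>A u\<close> by an element of that kernel.\<close>

lemma finite_descent_of_sum:
  assumes "\<And>x. \<exists>u. op_power A m *\<^sub>V (x - A *\<^sub>V u) = 0"
  shows "\<exists>u. op_power A m *\<^sub>V x = op_power A (Suc m) *\<^sub>V u"
  using assms[of x] by (auto simp: cblinfun_linear op_power_Suc_apply')

lemma surj_of_sum:
  assumes ker: "op_ker A = {0}" and sum: "\<And>x. \<exists>u. op_power A m *\<^sub>V (x - A *\<^sub>V u) = 0"
  shows "\<exists>u. A *\<^sub>V u = x"
proof -
  have "y = 0" if "op_power A n *\<^sub>V y = 0" for n y
    using that
  proof (induction n)
    case (Suc n)
    then show ?case
      using ker by (auto simp: op_power_Suc_apply op_ker_def)
  qed simp
  then show ?thesis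
    using sum[of x] by (metis eq_iff_diff_eq_0)
qed

text \<open>The range is closed and of finite codimension, hence complemented, which provides a generalized inverse
\<open>S\<close>. Since \<open>A S\<close> is the identity on the range, \<open>A S - 1\<close> is determined by its values on the finite-dimensional
kernel of \<open>A^m\<close>.\<close>

lemma right_regularizer_of_sum:
  fixes A :: "'a::cbanach \<Rightarrow>\<^sub>C\<^sub>L 'a"
  assumes \<Phi>: "A \<in> \<Phi>_plus" and sum: "\<And>x. \<exists>u. op_power A m *\<^sub>V (x - A *\<^sub>V u) = 0"
  obtains S where "bounded_clinear S" "finite_rank (\<lambda>x. A *\<^sub>V S x - x)"
proof -
  have A: "finite_dim (op_ker A)" "closed (op_range A)"
    using \<Phi> by (simp_all add: \<Phi>_plus_iff)
  obtain W where W: "finite W" "cspan W = op_ker (op_power A m)"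
    using finite_dim_csubspace_eq_span[OF finite_dim_ker_power[OF A(1)] csubspace_op_ker] by metis
  have "\<exists>w\<in>cspan W. x - w \<in> op_range A" for x
  proof -
    obtain u where "op_power A m *\<^sub>V (x - A *\<^sub>V u) = 0"
      using sum by blast
    then show ?thesis
      by (intro bexI[of _ "x - A *\<^sub>V u"]) (simp_all add: W(2) op_ker_def op_range_def)
  qed
  then have "A \<in> \<Phi>_l"
    using A complemented_finite_codim[OF csubspace_op_range A(2) W(1)] by (simp add: \<Phi>_l_iff)
  then obtain S where S: "bounded_clinear S" "\<And>x. A *\<^sub>V S (A *\<^sub>V x) = A *\<^sub>V x"
    using \<Phi>_l_regularizer by metis
  have "range (\<lambda>x. A *\<^sub>V S x - x) \<subseteq> (\<lambda>x. A *\<^sub>V S x - x) ` op_ker (op_power A m)"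
  proof
    fix y assume "y \<in> range (\<lambda>x. A *\<^sub>V S x - x)"
    then obtain x where x: "y = A *\<^sub>V S x - x"
      by blast
    obtain u where u: "op_power A m *\<^sub>V (x - A *\<^sub>V u) = 0"
      using sum by blast
    have "y = A *\<^sub>V S (x - A *\<^sub>V u) - (x - A *\<^sub>V u)"
      by (simp add: x bounded_clinearD[OF S(1)] cblinfun_linear S(2))
    then show "y \<in> (\<lambda>x. A *\<^sub>V S x - x) ` op_ker (op_power A m)"
      using u by (auto simp: op_ker_def)
  qed
  moreover have "finite_dim ((\<lambda>x. A *\<^sub>V S x - x) ` op_ker (op_power A m))"
    by (intro finite_dim_image finite_dim_ker_power A bounded_clinear_intros S(1))
  ultimately have "finite_rank (\<lambda>x. A *\<^sub>V S x - x)"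
    unfolding finite_rank_def by (rule finite_dim_subset[rotated])
  then show thesis
    using that S(1) by blast
qed

section \<open>Spectra of upper triangular operators\<close>

theorem theorem3p4:
  fixes A :: "'x::cbanach \<Rightarrow>\<^sub>C\<^sub>L 'x"
    and B :: "'y::cbanach \<Rightarrow>\<^sub>C\<^sub>L 'y"
    and C :: "'y \<Rightarrow>\<^sub>C\<^sub>L 'x"
  assumes "ecdim (UNIV :: 'x set) = \<infinity>"
    and "ecdim (UNIV :: 'y set) = \<infinity>"
  shows
    "\<sigma>_l (upper_tri_op A C B) \<union> SVEP_fail (dual_op A) = \<sigma>_l A \<union> \<sigma>_l B \<union> SVEP_fail (dual_op A) \<and>
     \<sigma>_lb (upper_tri_op A C B) \<union> SVEP_fail (dual_op A) = \<sigma>_lb A \<union> \<sigma>_lb B \<union> SVEP_fail (dual_op A) \<and>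
     \<sigma>_ab (upper_tri_op A C B) \<union> SVEP_fail (dual_op A) = \<sigma>_ab A \<union> \<sigma>_ab B \<union> SVEP_fail (dual_op A) \<and>
     \<sigma>_le (upper_tri_op A C B) \<union> SVEP_fail (dual_op A) = \<sigma>_le A \<union> \<sigma>_le B \<union> SVEP_fail (dual_op A) \<and>
     \<sigma>_SF_plus (upper_tri_op A C B) \<union> SVEP_fail (dual_op A) = \<sigma>_SF_plus A \<union> \<sigma>_SF_plus B \<union> SVEP_fail (dual_op A)"
proof -
  \<comment> \<open>For a point with SVEP of the dual, each class contains the shifted matrix iff it contains both shifted diagonal entries.\<close>
  have iffs: "(left_invertible M \<longleftrightarrow> left_invertible A' \<and> left_invertible B') \<and>
      (M \<in> \<Phi>_lb \<longleftrightarrow> A' \<in> \<Phi>_lb \<and> B' \<in> \<Phi>_lb) \<and> (M \<in> \<Phi>_ab \<longleftrightarrow> A' \<in> \<Phi>_ab \<and> B' \<in> \<Phi>_ab) \<and>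
      (M \<in> \<Phi>_l \<longleftrightarrow> A' \<in> \<Phi>_l \<and> B' \<in> \<Phi>_l) \<and> (M \<in> \<Phi>_plus \<longleftrightarrow> A' \<in> \<Phi>_plus \<and> B' \<in> \<Phi>_plus)"
    if z: "z \<notin> SVEP_fail (dual_op A)" and A': "A' = A - z *\<^sub>C id_cblinfun"
      and B': "B' = B - z *\<^sub>C id_cblinfun" and M: "M = upper_tri_op A' C B'" for z A' B' M
  proof -
    have svep: "SVEP_at (dual_op A) z"
      using z by (simp add: SVEP_fail_def)
    have sum: "\<exists>m. \<forall>x. \<exists>u. op_power A' m *\<^sub>V (x - A' *\<^sub>V u) = 0" if "A' \<in> \<Phi>_plus"
      using range_plus_ker_power_of_dual_SVEP[OF svep] that unfolding A' by metis
    have reg: "\<exists>S. bounded_clinear S \<and> finite_rank (\<lambda>x. A' *\<^sub>V S x - x)" if h: "A' \<in> \<Phi>_plus"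
    proof -
      obtain m where "\<And>x. \<exists>u. op_power A' m *\<^sub>V (x - A' *\<^sub>V u) = 0"
        using sum[OF h] by blast
      from right_regularizer_of_sum[OF h this] show ?thesis
        by metis
    qed
    have plus: "B' \<in> \<Phi>_plus" if "M \<in> \<Phi>_plus"
    proof -
      have "A' \<in> \<Phi>_plus"
        using that unfolding M by (rule \<Phi>_plus_upper_tri_fst)
      then obtain S where S: "bounded_clinear S" "finite_rank (\<lambda>x. A' *\<^sub>V S x - x)"
        using reg by blast
      show ?thesis
        by (rule \<Phi>_plus_upper_tri_snd[OF that[unfolded M] S])
    qed
    have l: "B' \<in> \<Phi>_l" if "M \<in> \<Phi>_l"
    proof -
      have "A' \<in> \<Phi>_l"
        using that unfolding M by (rule \<Phi>_l_upper_tri_fst)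
      then obtain S where S: "bounded_clinear S" "finite_rank (\<lambda>x. A' *\<^sub>V S x - x)"
        using reg \<Phi>_l_subset_\<Phi>_plus by blast
      show ?thesis
        by (rule \<Phi>_l_upper_tri_snd[OF that[unfolded M] S])
    qed
    have asc: "asc B' < \<infinity>" if h: "A' \<in> \<Phi>_plus" "asc M < \<infinity>"
    proof -
      obtain m where m: "\<And>x. \<exists>u. op_power A' m *\<^sub>V (x - A' *\<^sub>V u) = 0"
        using sum[OF h(1)] by blast
      show ?thesis
        by (rule asc_upper_tri_snd[OF h(2)[unfolded M] finite_descent_of_sum[OF m]])
    qed
    have left: "left_invertible B'" if "left_invertible M"
    proof -
      have "left_invertible A'"
        using that unfolding M by (rule left_invertible_upper_tri_fst)
      then have A'_\<Phi>: "A' \<in> \<Phi>_plus" "op_ker A' = {0}"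
        using left_invertible_imp_\<Phi>_l[of A'] \<Phi>_l_subset_\<Phi>_plus by auto
      obtain m where m: "\<And>x. \<exists>u. op_power A' m *\<^sub>V (x - A' *\<^sub>V u) = 0"
        using sum[OF A'_\<Phi>(1)] by blast
      show ?thesis
        by (rule left_invertible_upper_tri_snd[OF that[unfolded M] surj_of_sum[OF A'_\<Phi>(2) m]])
    qed
    note fst = \<Phi>_plus_upper_tri_fst[of A' C B', folded M] \<Phi>_l_upper_tri_fst[of A' C B', folded M]
      left_invertible_upper_tri_fst[of A' C B', folded M] asc_upper_tri_fst[of A' C B', folded M]
    note diag = \<Phi>_plus_upper_tri[of A' B' C, folded M] \<Phi>_l_upper_tri[of A' B' C, folded M]
      left_invertible_upper_tri[of A' B' C, folded M] asc_upper_tri[of A' B' C, folded M]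
    show ?thesis
      unfolding \<Phi>_lb_def \<Phi>_ab_def mem_Collect_eq
      using plus l asc left fst diag \<Phi>_l_subset_\<Phi>_plus by blast
  qed
  show ?thesis
    unfolding \<sigma>_l_def \<sigma>_lb_def \<sigma>_ab_def \<sigma>_le_def \<sigma>_SF_plus_def upper_tri_op_minus_scalar
    using iffs[OF _ refl refl refl] by (intro conjI; auto)
qed

end
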